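(* Let $(\mathfrak{g},[~,~]_\mathfrak{g},N)$ be a Nijenhuis Lie algebra and $(V,\rho,S)$ be a Nijenhuis representation of it. Then there is a bijection $$\mathcal{E}xt((\mathfrak{g},N);(V,S))\;\cong\;H^2((\mathfrak{g},N);(V,S))$$ between the set of isomorphism classes of abelian extensions of $(\mathfrak{g},[~,~]_\mathfrak{g},N)$ by $(V,S)$ whose induced Nijenhuis representation is $(V,\rho,S)$, and the second cohomology group of $(\mathfrak{g},[~,~]_\mathfrak{g},N)$ with coefficients in $(V,\rho,S)$.
   Context: All vector spaces are over a fixed field. A Nijenhuis operator on a Lie algebra $(\mathfrak{g},[~,~]_\mathfrak{g})$ is a linear map $N:\mathfrak{g}\to\mathfrak{g}$ with $[N(x),N(y)]_\mathfrak{g}=N([N(x),y]_\mathfrak{g}+[x,N(y)]_\mathfrak{g}-N[x,y]_\mathfrak{g})$ for all $x,y\in\mathfrak{g}$. A Nijenhuis Lie algebra $(\mathfrak{g},[~,~]_\mathfrak{g},N)$ is a Lie algebra with a Nijenhuis operator $N$. A homomorphism of Nijenhuis Lie algebras is a Lie algebra homomorphism commuting with the Nijenhuis operators; it is an isomorphism if bijective. A Nijenhuis representation of $(\mathfrak{g},[~,~]_\mathfrak{g},N)$ is a triple $(V,\rho,S)$ with $(V,\rho)$ a representation of the Lie algebra $\mathfrak{g}$ and $S:V\to V$ linear with $\rho_{N(x)}S(v)=S(\rho_{N(x)}v+\rho_xS(v)-S(\rho_xv))$ for all $x\in\mathfrak{g}$, $v\in V$. A 2-cocycle of $(\mathfrak{g},[~,~]_\mathfrak{g},N)$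 with coefficients in $(V,\rho,S)$ is a pair $(\chi,F)$ of linear maps $\chi:\wedge^2\mathfrak{g}\to V$, $F:\mathfrak{g}\to V$ such that for all $x,y,z\in\mathfrak{g}$: (1) $\rho_x\chi(y,z)+\rho_y\chi(z,x)+\rho_z\chi(x,y)-\chi([x,y]_\mathfrak{g},z)-\chi([y,z]_\mathfrak{g},x)-\chi([z,x]_\mathfrak{g},y)=0$; (2) $\chi(N(x),N(y))-S(\chi(N(x),y)+\chi(x,N(y))-S(\chi(x,y)))-F([N(x),y]_\mathfrak{g}+[x,N(y)]_\mathfrak{g}-N[x,y]_\mathfrak{g})+\rho_{N(x)}F(y)-\rho_{N(y)}F(x)-S(\rho_xF(y)-\rho_yF(x)-F[x,y]_\mathfrak{g})=0$. Two 2-cocycles $(\chi,F)$, $(\chi',F')$ are cohomologous if there is a linear map $\varphi:\mathfrak{g}\to V$ with $\chi(x,y)-\chi'(x,y)=\rho_x\varphi(y)-\rho_y\varphi(x)-\varphi([x,y]_\mathfrak{g})$ and $F(x)-F'(x)=S(\varphi(x))-\varphi(N(x))$ for all $x,y\in\mathfrak{g}$. $H^2((\mathfrak{g},N);(V,S))$ is the set of 2-cocycles modulo the cohomologous relation. Regard $(V,S)$ as a Nijenhuis Lie algebra with trivial Lie bracket. An abelian extension of $(\mathfrak{g},[~,~]_\mathfrak{g},N)$ by $(V,S)$ is a short exact sequence of Nijenhuis Lie algebras $0\to(V,[~,~]_V=0,S)\xrightarrow{i}(\mathfrak{e},[~,~]_\mathfrak{e},U)\xrightarrow{p}(\mathfrak{g},[~,~]_\mathfrak{g},N)\to0$;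 $V$ is identified with $i(V)\subset\mathfrak{e}$. Its induced Nijenhuis representation is $(V,\rho,S)$ with $\rho_xv=[s(x),v]_\mathfrak{e}$, where $s:\mathfrak{g}\to\mathfrak{e}$ is any section (a linear map with $ps=\mathrm{Id}_\mathfrak{g}$); it does not depend on $s$. Two abelian extensions $(\mathfrak{e},U;i,p)$, $(\mathfrak{e}',U';i',p')$ are isomorphic if there is an isomorphism of Nijenhuis Lie algebras $\Phi:\mathfrak{e}\to\mathfrak{e}'$ with $\Phi\circ i=i'$ and $p'\circ\Phi=p$. $\mathcal{E}xt((\mathfrak{g},N);(V,S))$ is the set of isomorphism classes of abelian extensions whose induced Nijenhuis representation is the given $(V,\rho,S)$. *)

theory Defs
  imports "Jordan_Normal_Form.Missing_VectorSpace"
begin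

text \<open>Linear algebra over a field \<open>K\<close> is carrier-based: \<^locale>\<open>vectorspace\<close> and
  \<^locale>\<open>linear_map\<close>. Maps are unconstrained outside the carriers; every relation below
  compares maps on carriers only, so such values never distinguish two equivalence classes.\<close>

record ('k, 'a) lie_algebra = "('k, 'a) module" +
  bracket :: "'a \<Rightarrow> 'a \<Rightarrow> 'a"  (\<open>\<lblot>_, _\<rblot>\<index>\<close>)

record ('k, 'a) nijenhuis_lie_algebra = "('k, 'a) lie_algebra" +
  nij :: "'a \<Rightarrow> 'a"

definition bilinear_map where
  "bilinear_map K A B C b \<longleftrightarrow>
     (\<forall>y\<in>carrier B. linear_map K A C (\<lambda>x. b x y)) \<and>
     (\<forall>x\<in>carrier A. linear_map K B C (\<lambda>y. b x y))"

text \<open>The characteristic of \<open>K\<close> is arbitrary, so skew-symmetry is the alternating law.\<close>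

locale lie_algebra = vectorspace K L
  for K and L :: "('k, 'a, 'm) lie_algebra_scheme" (structure) +
  assumes bracket_bilinear: "bilinear_map K L L L (bracket L)"
    and bracket_alternating: "x \<in> carrier L \<Longrightarrow> \<lblot>x, x\<rblot> = \<zero>"
    and jacobi: "\<lbrakk>x \<in> carrier L; y \<in> carrier L; z \<in> carrier L\<rbrakk> \<Longrightarrow>
      \<lblot>x, \<lblot>y, z\<rblot>\<rblot> \<oplus> \<lblot>y, \<lblot>z, x\<rblot>\<rblot> \<oplus> \<lblot>z, \<lblot>x, y\<rblot>\<rblot> = \<zero>"

locale nijenhuis_lie_algebra = lie_algebra K L
  for K and L :: "('k, 'a, 'm) nijenhuis_lie_algebra_scheme" (structure) +
  assumes nij_linear: "linear_map K L L (nij L)"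
    and nij_bracket: "\<lbrakk>x \<in> carrier L; y \<in> carrier L\<rbrakk> \<Longrightarrow>
      \<lblot>nij L x, nij L y\<rblot> = nij L (\<lblot>nij L x, y\<rblot> \<oplus> \<lblot>x, nij L y\<rblot> \<ominus> nij L \<lblot>x, y\<rblot>)"

definition nijenhuis_hom where
  "nijenhuis_hom K L M f \<longleftrightarrow>
     linear_map K L M f \<and>
     (\<forall>x\<in>carrier L. \<forall>y\<in>carrier L. f \<lblot>x, y\<rblot>\<^bsub>L\<^esub> = \<lblot>f x, f y\<rblot>\<^bsub>M\<^esub>) \<and>
     (\<forall>x\<in>carrier L. f (nij L x) = nij M (f x))"

definition nijenhuis_iso where
  "nijenhuis_iso K L M f \<longleftrightarrow> nijenhuis_hom K L M f \<and> bij_betw f (carrier L) (carrier M)"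

locale lie_representation = lie_algebra K G + V: vectorspace K V
  for K and G :: "('k, 'g, 'm) lie_algebra_scheme" (structure) and V and \<rho> +
  assumes rep_bilinear: "bilinear_map K G V V \<rho>"
    and rep_bracket: "\<lbrakk>x \<in> carrier G; y \<in> carrier G; v \<in> carrier V\<rbrakk> \<Longrightarrow>
      \<rho> \<lblot>x, y\<rblot> v = \<rho> x (\<rho> y v) \<ominus>\<^bsub>V\<^esub> \<rho> y (\<rho> x v)"

locale nijenhuis_representation =
  nijenhuis_lie_algebra K G + lie_representation K G V \<rho>
  for K and G :: "('k, 'g, 'm) nijenhuis_lie_algebra_scheme" (structure)
    and V and \<rho> and S +
  assumes S_linear: "linear_map K V V S"
    and rep_nij: "\<lbrakk>x \<in> carrier G; v \<in> carrier V\<rbrakk> \<Longrightarrow>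
      \<rho> (nij G x) (S v) = S (\<rho> (nij G x) v \<oplus>\<^bsub>V\<^esub> \<rho> x (S v) \<ominus>\<^bsub>V\<^esub> S (\<rho> x v))"

text \<open>A linear map out of the exterior square is encoded as an alternating bilinear map.\<close>

definition two_cocycle where
  "two_cocycle K G V \<rho> S \<chi> F \<longleftrightarrow>
     bilinear_map K G G V \<chi> \<and> (\<forall>x\<in>carrier G. \<chi> x x = \<zero>\<^bsub>V\<^esub>) \<and> linear_map K G V F \<and>
     (\<forall>x\<in>carrier G. \<forall>y\<in>carrier G. \<forall>z\<in>carrier G.
        \<rho> x (\<chi> y z) \<oplus>\<^bsub>V\<^esub> \<rho> y (\<chi> z x) \<oplus>\<^bsub>V\<^esub> \<rho> z (\<chi> x y)
          \<ominus>\<^bsub>V\<^esub> \<chi> \<lblot>x, y\<rblot>\<^bsub>G\<^esub> z \<ominus>\<^bsub>V\<^esub> \<chi> \<lblot>y, z\<rblot>\<^bsub>G\<^esub> x \<ominus>\<^bsub>V\<^esub> \<chi> \<lblot>z, x\<rblot>\<^bsub>G\<^esub> y = \<zero>\<^bsub>V\<^esub>) \<and>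
     (\<forall>x\<in>carrier G. \<forall>y\<in>carrier G.
        \<chi> (nij G x) (nij G y)
          \<ominus>\<^bsub>V\<^esub> S (\<chi> (nij G x) y \<oplus>\<^bsub>V\<^esub> \<chi> x (nij G y) \<ominus>\<^bsub>V\<^esub> S (\<chi> x y))
          \<ominus>\<^bsub>V\<^esub> F (\<lblot>nij G x, y\<rblot>\<^bsub>G\<^esub> \<oplus>\<^bsub>G\<^esub> \<lblot>x, nij G y\<rblot>\<^bsub>G\<^esub> \<ominus>\<^bsub>G\<^esub> nij G \<lblot>x, y\<rblot>\<^bsub>G\<^esub>)
          \<oplus>\<^bsub>V\<^esub> \<rho> (nij G x) (F y) \<ominus>\<^bsub>V\<^esub> \<rho> (nij G y) (F x)
          \<ominus>\<^bsub>V\<^esub> S (\<rho> x (F y) \<ominus>\<^bsub>V\<^esub> \<rho> y (F x) \<ominus>\<^bsub>V\<^esub> F \<lblot>x, y\<rblot>\<^bsub>G\<^esub>) = \<zero>\<^bsub>V\<^esub>)"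

definition two_cocycles where
  "two_cocycles K G V \<rho> S = {(\<chi>, F). two_cocycle K G V \<rho> S \<chi> F}"

definition cohomologous where
  "cohomologous K G V \<rho> S =
     {((\<chi>, F), (\<chi>', F')). two_cocycle K G V \<rho> S \<chi> F \<and> two_cocycle K G V \<rho> S \<chi>' F' \<and>
        (\<exists>\<phi>. linear_map K G V \<phi> \<and>
           (\<forall>x\<in>carrier G. \<forall>y\<in>carrier G.
              \<chi> x y \<ominus>\<^bsub>V\<^esub> \<chi>' x y = \<rho> x (\<phi> y) \<ominus>\<^bsub>V\<^esub> \<rho> y (\<phi> x) \<ominus>\<^bsub>V\<^esub> \<phi> \<lblot>x, y\<rblot>\<^bsub>G\<^esub>) \<and>
           (\<forall>x\<in>carrier G. F x \<ominus>\<^bsub>V\<^esub> F' x = S (\<phi> x) \<ominus>\<^bsub>V\<^esub> \<phi> (nij G x)))}"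

definition H2 where
  "H2 K G V \<rho> S = two_cocycles K G V \<rho> S // cohomologous K G V \<rho> S"

definition trivial_nijenhuis ::
    "('k, 'v, 'n) module_scheme \<Rightarrow> ('v \<Rightarrow> 'v) \<Rightarrow> ('k, 'v) nijenhuis_lie_algebra" where
  "trivial_nijenhuis V S =
     \<lparr>carrier = carrier V, mult = mult V, one = one V, zero = zero V, add = add V,
      smult = smult V, bracket = (\<lambda>_ _. \<zero>\<^bsub>V\<^esub>), nij = S\<rparr>"

definition abelian_extension where
  "abelian_extension K G V S E i p \<longleftrightarrow>
     nijenhuis_lie_algebra K E \<and>
     nijenhuis_hom K (trivial_nijenhuis V S) E i \<and>
     nijenhuis_hom K E G p \<and>
     inj_on i (carrier V) \<and>
     i ` carrier V = {e \<in> carrier E. p e = \<zero>\<^bsub>G\<^esub>} \<and>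
     p ` carrier E = carrier G"

definition is_section where
  "is_section K G E p s \<longleftrightarrow> linear_map K G E s \<and> (\<forall>x\<in>carrier G. p (s x) = x)"

text \<open>The induced representation sends \<open>v\<close> to \<open>\<lblot>s x, v\<rblot>\<close> in \<open>E\<close>, with \<open>V\<close> identified with
  \<open>i ` carrier V\<close>. The choice of section is immaterial, see \<open>bracket_section_unique\<close>.\<close>

definition induces_representation where
  "induces_representation K G V \<rho> E i p \<longleftrightarrow>
     (\<exists>s. is_section K G E p s \<and>
       (\<forall>x\<in>carrier G. \<forall>v\<in>carrier V. i (\<rho> x v) = \<lblot>s x, i v\<rblot>\<^bsub>E\<^esub>))"

lemma bracket_section_unique:
  assumes ext: "abelian_extension K G V S E i p"
    and s: "is_section K G E p s" and t: "is_section K G E p t"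
    and x: "x \<in> carrier G" and v: "v \<in> carrier V"
  shows "\<lblot>s x, i v\<rblot>\<^bsub>E\<^esub> = \<lblot>t x, i v\<rblot>\<^bsub>E\<^esub>"
proof -
  interpret E: nijenhuis_lie_algebra K E using ext by (simp add: abelian_extension_def)
  interpret p: linear_map K E G p
    using ext by (simp add: abelian_extension_def nijenhuis_hom_def)
  interpret s: linear_map K G E s using s by (simp add: is_section_def)
  interpret t: linear_map K G E t using t by (simp add: is_section_def)
  have sx: "s x \<in> carrier E" and tx: "t x \<in> carrier E"
    using x s.f_im t.f_im by auto
  have G: "abelian_group G"
    using linear_map.axioms(2)[OF p.linear_map_axioms] by (simp add: vectorspace_def module_def)
  have "p (s x \<ominus>\<^bsub>E\<^esub> t x) = x \<ominus>\<^bsub>G\<^esub> x"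
    using s t x sx tx by (simp add: is_section_def p.f_minus)
  then have "p (s x \<ominus>\<^bsub>E\<^esub> t x) = \<zero>\<^bsub>G\<^esub>" using x by (simp add: abelian_group.r_neg[OF G] a_minus_def)
  then obtain w where w: "w \<in> carrier V" "s x \<ominus>\<^bsub>E\<^esub> t x = i w"
    using ext sx tx E.minus_closed unfolding abelian_extension_def by blast
  have iv: "i v \<in> carrier E" using ext v unfolding abelian_extension_def by blast
  have iw: "i w \<in> carrier E" using ext w(1) unfolding abelian_extension_def by blast
  have hom: "nijenhuis_hom K (trivial_nijenhuis V S) E i"
    using ext by (simp add: abelian_extension_def)
  then interpret i: linear_map K "trivial_nijenhuis V S" E i by (simp add: nijenhuis_hom_def)
  have tc: "carrier (trivial_nijenhuis V S) = carrier V"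
    and tb: "\<lblot>w, v\<rblot>\<^bsub>trivial_nijenhuis V S\<^esub> = \<zero>\<^bsub>V\<^esub>"
    by (simp_all add: trivial_nijenhuis_def)
  have "i \<lblot>w, v\<rblot>\<^bsub>trivial_nijenhuis V S\<^esub> = \<lblot>i w, i v\<rblot>\<^bsub>E\<^esub>"
    using hom w(1) v tc by (simp only: nijenhuis_hom_def)
  then have "\<lblot>i w, i v\<rblot>\<^bsub>E\<^esub> = i \<zero>\<^bsub>V\<^esub>" using tb by simp
  also have "\<dots> = \<zero>\<^bsub>E\<^esub>" using i.f0_is_0 by (simp add: trivial_nijenhuis_def)
  finally have 0: "\<lblot>i w, i v\<rblot>\<^bsub>E\<^esub> = \<zero>\<^bsub>E\<^esub>" .
  interpret b: linear_map K E E "\<lambda>e. \<lblot>e, i v\<rblot>\<^bsub>E\<^esub>"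
    using E.bracket_bilinear iv by (simp add: bilinear_map_def)
  have "s x = (s x \<ominus>\<^bsub>E\<^esub> t x) \<oplus>\<^bsub>E\<^esub> t x"
    using sx tx by (simp add: E.minus_eq E.a_assoc E.l_neg)
  then have "s x = i w \<oplus>\<^bsub>E\<^esub> t x" using w(2) by simp
  then have "\<lblot>s x, i v\<rblot>\<^bsub>E\<^esub> = \<lblot>i w, i v\<rblot>\<^bsub>E\<^esub> \<oplus>\<^bsub>E\<^esub> \<lblot>t x, i v\<rblot>\<^bsub>E\<^esub>"
    using b.f_add iw tx by simp
  then show ?thesis using 0 b.f_im tx by auto
qed

definition abelian_extensions ::
    "('k, 'r) ring_scheme \<Rightarrow> ('k, 'g, 'm) nijenhuis_lie_algebra_scheme \<Rightarrow>
     ('k, 'v, 'n) module_scheme \<Rightarrow> ('g \<Rightarrow> 'v \<Rightarrow> 'v) \<Rightarrow> ('v \<Rightarrow> 'v) \<Rightarrow>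
     (('k, 'e) nijenhuis_lie_algebra \<times> ('v \<Rightarrow> 'e) \<times> ('e \<Rightarrow> 'g)) set" where
  "abelian_extensions K G V \<rho> S =
     {(E, i, p). abelian_extension K G V S E i p \<and> induces_representation K G V \<rho> E i p}"

definition extension_iso where
  "extension_iso K G V \<rho> S =
     {((E, i, p), (E', i', p')).
        (E, i, p) \<in> abelian_extensions K G V \<rho> S \<and> (E', i', p') \<in> abelian_extensions K G V \<rho> S \<and>
        (\<exists>\<Phi>. nijenhuis_iso K E E' \<Phi> \<and>
           (\<forall>v\<in>carrier V. \<Phi> (i v) = i' v) \<and>
           (\<forall>e\<in>carrier E. p' (\<Phi> e) = p e))}"

text \<open>The type \<open>'e\<close> is the universe from which the underlying sets of the extensions are
  taken (as subsets). An extension is equinumerous with \<open>carrier V \<times> carrier G\<close>, so every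
  isomorphism class has a representative in \<open>'e\<close> as soon as that product embeds into \<open>'e\<close>.\<close>

definition Ext ::
    "('k, 'r) ring_scheme \<Rightarrow> ('k, 'g, 'm) nijenhuis_lie_algebra_scheme \<Rightarrow>
     ('k, 'v, 'n) module_scheme \<Rightarrow> ('g \<Rightarrow> 'v \<Rightarrow> 'v) \<Rightarrow> ('v \<Rightarrow> 'v) \<Rightarrow>
     (('k, 'e) nijenhuis_lie_algebra \<times> ('v \<Rightarrow> 'e) \<times> ('e \<Rightarrow> 'g)) set set" where
  "Ext K G V \<rho> S = abelian_extensions K G V \<rho> S // extension_iso K G V \<rho> S"

end

theory Submission
  imports Defs
begin

text \<open>Choose a section \<open>s\<close> of an abelian extension \<open>V \<rightarrow> E \<rightarrow> G\<close>. Then \<open>(v, x) \<mapsto> i v \<oplus> s x\<close> identifies the vector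
  space \<open>E\<close> with \<open>V \<oplus> G\<close>, and the structure of \<open>E\<close> is determined by the induced representation together
  with the two defects of \<open>s\<close>, namely \<open>\<chi> x y = \<lblot>s x, s y\<rblot> \<ominus> s \<lblot>x, y\<rblot>\<close> and
  \<open>F x = U (s x) \<ominus> s (N x)\<close>, where \<open>U\<close> is the Nijenhuis operator of \<open>E\<close>. Both take values in
  \<open>V\<close>. Conversely, any pair \<open>(\<chi>, F)\<close> defines a bracket and an operator on \<open>V \<oplus> G\<close>, called the
  twisted sum below.

  Three facts carry the proof. The twisted sum of \<open>(\<chi>, F)\<close> is a Nijenhuis Lie algebra if and only if
  \<open>(\<chi>, F)\<close> is a 2-cocycle (\<open>two_cocycle_of_twisted\<close>, \<open>twisted_of_two_cocycle\<close>). Every extension that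
  induces \<open>\<rho>\<close> is equivalent to the twisted sum of some cocycle
  (\<open>abelian_extension_equivalent_twisted\<close>). An equivalence between two twisted sums is the identity
  on \<open>V\<close> and induces the identity on \<open>G\<close>, hence is a shear \<open>(v, x) \<mapsto> (v \<oplus> \<phi> x, x)\<close> with \<open>\<phi>\<close>
  linear; such a shear is a homomorphism if and only if \<open>\<phi>\<close> exhibits the two cocycles as
  cohomologous (\<open>equivalent_twisted_extensions_iff\<close>).

  Matching an extension with the cocycles whose twisted sum is equivalent to it therefore induces a
  bijection of classes. The total spaces have to lie in the given type \<open>'e\<close>, so equivalence is
  defined between extensions in different types, and a twisted sum, which lives on
  \<open>carrier V \<times> carrier G\<close>, is moved into \<open>'e\<close> along the injection \<open>j\<close>
  (\<open>equivalent_extension_in_universe\<close>).\<close>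

section \<open>Cancellation in abelian groups\<close>

lemma (in abelian_group) a_inv_zero: "\<ominus> \<zero> = \<zero>"
  by (simp add: minus_equality)

text \<open>The method \<open>algebra\<close> normalises terms in rings; these are the rules it uses there, restricted
  to the additive group, so that it also decides identities between sums of vectors.\<close>

lemmas (in abelian_group) abelian_group_simprules
  [algebra abelian_group "zero G" "add G" "a_inv G" "a_minus G"] =
  a_closed zero_closed a_inv_closed minus_closed
  a_assoc l_zero l_neg a_comm minus_eq
  r_zero r_neg r_neg2 r_neg1 minus_add minus_minus a_inv_zero a_lcomm

text \<open>The premise has the shape of the second cocycle condition, with \<open>\<chi> (N x) (N y)\<close> as its first
  summand.\<close>

lemma (in abelian_group) solve_for_summand:
  assumes "a \<in> carrier G" "b \<in> carrier G" "c \<in> carrier G" "d \<in> carrier G" "e \<in> carrier G"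
    "f \<in> carrier G"
    and "a \<ominus> b \<ominus> c \<oplus> d \<ominus> e \<ominus> f = \<zero>"
  shows "a = b \<oplus> c \<ominus> d \<oplus> e \<oplus> f"
proof -
  have "a = (a \<ominus> b \<ominus> c \<oplus> d \<ominus> e \<ominus> f) \<oplus> (b \<oplus> c \<ominus> d \<oplus> e \<oplus> f)"
    using assms(1-6) by algebra
  then show ?thesis using assms by simp
qed

text \<open>The cancellation in the Jacobi identity of a twisted sum: \<open>a, \<dots>, f\<close> stand for the six iterated
  actions \<open>\<rho> x (\<rho> y w)\<close>, each of which occurs once in a nested bracket and once, with the
  opposite sign, in the expansion of an action \<open>\<rho> \<lblot>x, y\<rblot> w\<close>. What remains are the terms
  of the cocycle condition.\<close>

lemma (in abelian_group) jacobi_cancel: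
  assumes "a \<in> carrier G" "b \<in> carrier G" "c \<in> carrier G" "d \<in> carrier G" "e \<in> carrier G"
    "f \<in> carrier G" "g \<in> carrier G" "h \<in> carrier G" "i \<in> carrier G" "j \<in> carrier G"
    "k \<in> carrier G" "l \<in> carrier G"
  shows "(a \<oplus> \<ominus> b \<oplus> g \<oplus> (\<ominus> d \<oplus> f) \<oplus> j) \<oplus> (d \<oplus> \<ominus> c \<oplus> h \<oplus> (\<ominus> e \<oplus> b) \<oplus> k)
    \<oplus> (e \<oplus> \<ominus> f \<oplus> i \<oplus> (\<ominus> a \<oplus> c) \<oplus> l) = g \<oplus> h \<oplus> i \<oplus> l \<oplus> j \<oplus> k"
  using assms by algebra

text \<open>The cancellation in the Nijenhuis identity of a twisted sum: \<open>a\<close> and \<open>b\<close> stand for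
  \<open>\<rho> (N x) (F y)\<close> and \<open>\<rho> (N y) (F x)\<close>, which drop out once the cocycle condition has been
  solved for \<open>\<chi> (N x) (N y)\<close>.\<close>

lemma (in abelian_group) nijenhuis_cancel:
  assumes "a \<in> carrier G" "b \<in> carrier G" "c \<in> carrier G" "d \<in> carrier G" "e \<in> carrier G"
    "f \<in> carrier G" "g \<in> carrier G" "h \<in> carrier G" "i \<in> carrier G" "j \<in> carrier G"
    "k \<in> carrier G" "l \<in> carrier G" "m \<in> carrier G" "n \<in> carrier G" "r \<in> carrier G"
    "p \<in> carrier G" "q \<in> carrier G"
  shows "c \<oplus> e \<oplus> \<ominus> g \<oplus> a \<oplus> (\<ominus> d \<oplus> \<ominus> f \<oplus> h \<oplus> \<ominus> b)
      \<oplus> (k \<oplus> l \<oplus> \<ominus> m \<oplus> (r \<oplus> p \<oplus> \<ominus> q) \<oplus> \<ominus> a \<oplus> b \<oplus> (i \<oplus> \<ominus> j \<oplus> \<ominus> n))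
    = c \<oplus> (\<ominus> f \<oplus> \<ominus> j) \<oplus> k \<oplus> (e \<oplus> i \<oplus> \<ominus> d \<oplus> l) \<oplus> (\<ominus> g \<oplus> h \<oplus> \<ominus> m \<oplus> \<ominus> n) \<oplus> (r \<oplus> p \<oplus> \<ominus> q)"
proof -
  have "c \<oplus> e \<oplus> \<ominus> g \<oplus> a \<oplus> (\<ominus> d \<oplus> \<ominus> f \<oplus> h \<oplus> \<ominus> b)
      \<oplus> (k \<oplus> l \<oplus> \<ominus> m \<oplus> (r \<oplus> p \<oplus> \<ominus> q) \<oplus> \<ominus> a \<oplus> b \<oplus> (i \<oplus> \<ominus> j \<oplus> \<ominus> n))
    = (a \<oplus> \<ominus> a) \<oplus> ((b \<oplus> \<ominus> b) \<oplus>
      (c \<oplus> (\<ominus> f \<oplus> \<ominus> j) \<oplus> k \<oplus> (e \<oplus> i \<oplus> \<ominus> d \<oplus> l) \<oplus> (\<ominus> g \<oplus> h \<oplus> \<ominus> m \<oplus> \<ominus> n) \<oplus> (r \<oplus> p \<oplus> \<ominus> q)))"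
    using assms by (simp only: a_ac a_closed a_inv_closed)
  then show ?thesis using assms by (simp add: r_neg)
qed

lemma (in abelian_group) shear_bracket_cancel:
  assumes "a \<in> carrier G" "b \<in> carrier G" "c \<in> carrier G" "d \<in> carrier G" "e \<in> carrier G"
    "f \<in> carrier G" "g \<in> carrier G"
  shows "a \<ominus> b \<oplus> c \<oplus> d = a \<oplus> e \<ominus> (b \<oplus> f) \<oplus> g \<longleftrightarrow> c \<ominus> g = e \<ominus> f \<ominus> d"
proof -
  have "a \<ominus> b \<oplus> c \<oplus> d = (c \<ominus> g) \<oplus> (a \<ominus> b \<oplus> d \<oplus> g)"
    and "a \<oplus> e \<ominus> (b \<oplus> f) \<oplus> g = (e \<ominus> f \<ominus> d) \<oplus> (a \<ominus> b \<oplus> d \<oplus> g)"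
    using assms by algebra+
  then show ?thesis using assms by simp
qed

lemma (in abelian_group) shear_nij_cancel:
  assumes "a \<in> carrier G" "b \<in> carrier G" "c \<in> carrier G" "d \<in> carrier G" "e \<in> carrier G"
  shows "a \<oplus> b \<oplus> c = a \<oplus> d \<oplus> e \<longleftrightarrow> b \<ominus> e = d \<ominus> c"
proof -
  have "a \<oplus> b \<oplus> c = (b \<ominus> e) \<oplus> (a \<oplus> c \<oplus> e)" and "a \<oplus> d \<oplus> e = (d \<ominus> c) \<oplus> (a \<oplus> c \<oplus> e)"
    using assms by algebra+
  then show ?thesis using assms by simp
qed

section \<open>Linear and bilinear maps\<close>

lemma linear_map_iff:
  "linear_map K A B f \<longleftrightarrow> vectorspace K A \<and> vectorspace K B \<and>
     (\<forall>x\<in>carrier A. f x \<in> carrier B) \<and>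
     (\<forall>x\<in>carrier A. \<forall>y\<in>carrier A. f (x \<oplus>\<^bsub>A\<^esub> y) = f x \<oplus>\<^bsub>B\<^esub> f y) \<and>
     (\<forall>a\<in>carrier K. \<forall>x\<in>carrier A. f (a \<odot>\<^bsub>A\<^esub> x) = a \<odot>\<^bsub>B\<^esub> f x)"
  by (auto simp: linear_map_def vectorspace_def mod_hom_def mod_hom_axioms_def module_hom_def)

lemma linear_mapD:
  assumes "linear_map K A B f"
  shows "x \<in> carrier A \<Longrightarrow> f x \<in> carrier B"
    and "x \<in> carrier A \<Longrightarrow> y \<in> carrier A \<Longrightarrow> f (x \<oplus>\<^bsub>A\<^esub> y) = f x \<oplus>\<^bsub>B\<^esub> f y"
    and "a \<in> carrier K \<Longrightarrow> x \<in> carrier A \<Longrightarrow> f (a \<odot>\<^bsub>A\<^esub> x) = a \<odot>\<^bsub>B\<^esub> f x"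
    and "f \<zero>\<^bsub>A\<^esub> = \<zero>\<^bsub>B\<^esub>"
    and "x \<in> carrier A \<Longrightarrow> f (\<ominus>\<^bsub>A\<^esub> x) = \<ominus>\<^bsub>B\<^esub> f x"
    and "x \<in> carrier A \<Longrightarrow> y \<in> carrier A \<Longrightarrow> f (x \<ominus>\<^bsub>A\<^esub> y) = f x \<ominus>\<^bsub>B\<^esub> f y"
proof -
  interpret linear_map K A B f by fact
  show "x \<in> carrier A \<Longrightarrow> f x \<in> carrier B"
    and "x \<in> carrier A \<Longrightarrow> y \<in> carrier A \<Longrightarrow> f (x \<oplus>\<^bsub>A\<^esub> y) = f x \<oplus>\<^bsub>B\<^esub> f y"
    and "a \<in> carrier K \<Longrightarrow> x \<in> carrier A \<Longrightarrow> f (a \<odot>\<^bsub>A\<^esub> x) = a \<odot>\<^bsub>B\<^esub> f x"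
    and "f \<zero>\<^bsub>A\<^esub> = \<zero>\<^bsub>B\<^esub>"
    and "x \<in> carrier A \<Longrightarrow> f (\<ominus>\<^bsub>A\<^esub> x) = \<ominus>\<^bsub>B\<^esub> f x"
    and "x \<in> carrier A \<Longrightarrow> y \<in> carrier A \<Longrightarrow> f (x \<ominus>\<^bsub>A\<^esub> y) = f x \<ominus>\<^bsub>B\<^esub> f y"
    by auto
qed

lemma linear_map_cong:
  assumes "linear_map K A B f" and "\<And>x. x \<in> carrier A \<Longrightarrow> g x = f x"
  shows "linear_map K A B g"
proof -
  interpret A: vectorspace K A using assms(1) by (simp add: linear_map_iff)
  show ?thesis using assms by (simp add: linear_map_iff)
qed

lemma linear_map_comp:
  assumes "linear_map K A B f" and "linear_map K B C g"
  shows "linear_map K A C (\<lambda>x. g (f x))"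
  using assms by (simp add: linear_map_iff)

lemma linear_map_inv_into:
  assumes f: "linear_map K A B f" and bij: "bij_betw f (carrier A) (carrier B)"
  shows "linear_map K B A (inv_into (carrier A) f)"
proof -
  interpret A: vectorspace K A using f by (simp add: linear_map_iff)
  let ?h = "inv_into (carrier A) f"
  have h: "?h y \<in> carrier A" "f (?h y) = y" if "y \<in> carrier B" for y
    using bij that by (auto simp: bij_betw_def f_inv_into_f inv_into_into)
  have eq: "?h y = x" if "x \<in> carrier A" "f x = y" for x y
    using bij that by (auto simp: bij_betw_def)
  show ?thesis
    using f h by (auto simp: linear_map_iff intro!: eq)
qed

lemma bilinear_mapI:
  assumes "vectorspace K A" "vectorspace K B" "vectorspace K C"
    and "\<And>x y. x \<in> carrier A \<Longrightarrow> y \<in> carrier B \<Longrightarrow> b x y \<in> carrier C"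
    and "\<And>x x' y. x \<in> carrier A \<Longrightarrow> x' \<in> carrier A \<Longrightarrow> y \<in> carrier B \<Longrightarrow>
      b (x \<oplus>\<^bsub>A\<^esub> x') y = b x y \<oplus>\<^bsub>C\<^esub> b x' y"
    and "\<And>x y y'. x \<in> carrier A \<Longrightarrow> y \<in> carrier B \<Longrightarrow> y' \<in> carrier B \<Longrightarrow>
      b x (y \<oplus>\<^bsub>B\<^esub> y') = b x y \<oplus>\<^bsub>C\<^esub> b x y'"
    and "\<And>a x y. a \<in> carrier K \<Longrightarrow> x \<in> carrier A \<Longrightarrow> y \<in> carrier B \<Longrightarrow>
      b (a \<odot>\<^bsub>A\<^esub> x) y = a \<odot>\<^bsub>C\<^esub> b x y"
    and "\<And>a x y. a \<in> carrier K \<Longrightarrow> x \<in> carrier A \<Longrightarrow> y \<in> carrier B \<Longrightarrow>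
      b x (a \<odot>\<^bsub>B\<^esub> y) = a \<odot>\<^bsub>C\<^esub> b x y"
  shows "bilinear_map K A B C b"
  using assms by (auto simp: bilinear_map_def linear_map_iff)

lemma bilinear_map_left: "bilinear_map K A B C b \<Longrightarrow> y \<in> carrier B \<Longrightarrow> linear_map K A C (\<lambda>x. b x y)"
  and bilinear_map_right: "bilinear_map K A B C b \<Longrightarrow> x \<in> carrier A \<Longrightarrow> linear_map K B C (b x)"
  by (simp_all add: bilinear_map_def)

text \<open>Equations and inverses can be tested after applying the injective map \<open>f\<close>, so only closure has to
  be assumed of the operations of \<open>A\<close>.\<close>

lemma vectorspace_pullback:
  assumes "vectorspace K B" and bij: "bij_betw f (carrier A) (carrier B)"
    and closed: "\<zero>\<^bsub>A\<^esub> \<in> carrier A"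
      "\<And>x y. x \<in> carrier A \<Longrightarrow> y \<in> carrier A \<Longrightarrow> x \<oplus>\<^bsub>A\<^esub> y \<in> carrier A"
      "\<And>a x. a \<in> carrier K \<Longrightarrow> x \<in> carrier A \<Longrightarrow> a \<odot>\<^bsub>A\<^esub> x \<in> carrier A"
    and f: "f \<zero>\<^bsub>A\<^esub> = \<zero>\<^bsub>B\<^esub>"
      "\<And>x y. x \<in> carrier A \<Longrightarrow> y \<in> carrier A \<Longrightarrow> f (x \<oplus>\<^bsub>A\<^esub> y) = f x \<oplus>\<^bsub>B\<^esub> f y"
      "\<And>a x. a \<in> carrier K \<Longrightarrow> x \<in> carrier A \<Longrightarrow> f (a \<odot>\<^bsub>A\<^esub> x) = a \<odot>\<^bsub>B\<^esub> f x"
  shows "vectorspace K A" and "linear_map K A B f"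
proof -
  interpret B: vectorspace K B by fact
  have im: "f x \<in> carrier B" if "x \<in> carrier A" for x
    using bij that by (auto simp: bij_betw_def)
  have eqI: "x = y" if "x \<in> carrier A" "y \<in> carrier A" "f x = f y" for x y
    using bij that by (auto simp: bij_betw_def inj_on_def)
  have surj: "\<exists>x\<in>carrier A. f x = y" if "y \<in> carrier B" for y
    using bij that by (metis bij_betw_imp_surj_on imageE)
  note [simp] = closed f im B.smult_l_distr B.smult_r_distr B.smult_assoc1
  show "vectorspace K A"
  proof (rule vs_criteria)
    show "field K" by (rule B.field_axioms)
    show "\<forall>v\<in>carrier A. \<exists>w\<in>carrier A. v \<oplus>\<^bsub>A\<^esub> w = \<zero>\<^bsub>A\<^esub>"
    proof
      fix v assume v: "v \<in> carrier A"
      then obtain w where w: "w \<in> carrier A" "f w = \<ominus>\<^bsub>B\<^esub> f v"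
        using surj[of "\<ominus>\<^bsub>B\<^esub> f v"] by auto
      then have "v \<oplus>\<^bsub>A\<^esub> w = \<zero>\<^bsub>A\<^esub>"
        using v by (intro eqI) (auto simp: B.M.r_neg)
      then show "\<exists>w\<in>carrier A. v \<oplus>\<^bsub>A\<^esub> w = \<zero>\<^bsub>A\<^esub>" using w by blast
    qed
  qed (auto intro!: eqI simp: B.M.a_ac)
  then show "linear_map K A B f"
    using assms im by (simp add: linear_map_iff)
qed

section \<open>Isomorphisms of Nijenhuis Lie algebras\<close>

context lie_algebra begin

lemmas bracket_left = linear_mapD[OF bilinear_map_left[OF bracket_bilinear]]
  and bracket_right = linear_mapD[OF bilinear_map_right[OF bracket_bilinear]]

lemma bracket_closed: "x \<in> carrier L \<Longrightarrow> y \<in> carrier L \<Longrightarrow> \<lblot>x, y\<rblot> \<in> carrier L"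
  by (rule bracket_left)

lemma bracket_skew:
  assumes x: "x \<in> carrier L" and y: "y \<in> carrier L"
  shows "\<lblot>y, x\<rblot> = \<ominus> \<lblot>x, y\<rblot>"
proof -
  have "\<lblot>y, x\<rblot> \<oplus> \<lblot>x, y\<rblot> = \<lblot>x \<oplus> y, x \<oplus> y\<rblot>"
    using x y bracket_alternating[OF x] bracket_alternating[OF y]
    by (simp add: bracket_left bracket_right)
  also have "\<dots> = \<zero>" using x y by (simp add: bracket_alternating)
  finally show ?thesis
    using x y by (simp add: M.minus_equality bracket_closed)
qed

end

lemma nijenhuis_hom_comp:
  assumes "nijenhuis_hom K A B f" and "nijenhuis_hom K B C g"
  shows "nijenhuis_hom K A C (\<lambda>x. g (f x))"
  using assms by (auto simp: nijenhuis_hom_def linear_mapD intro: linear_map_comp)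

lemma nijenhuis_hom_cong:
  assumes "nijenhuis_hom K A B f" and "\<And>x. x \<in> carrier A \<Longrightarrow> g x = f x"
    and "\<And>x y. x \<in> carrier A \<Longrightarrow> y \<in> carrier A \<Longrightarrow> \<lblot>x, y\<rblot>\<^bsub>A\<^esub> \<in> carrier A"
    and "\<And>x. x \<in> carrier A \<Longrightarrow> nij A x \<in> carrier A"
  shows "nijenhuis_hom K A B g"
  using assms by (auto simp: nijenhuis_hom_def intro: linear_map_cong)

lemma nijenhuis_iso_comp:
  assumes "nijenhuis_iso K A B f" and "nijenhuis_iso K B C g"
  shows "nijenhuis_iso K A C (\<lambda>x. g (f x))"
  using assms bij_betw_trans[of f "carrier A" "carrier B" g "carrier C"]
  by (auto simp: nijenhuis_iso_def comp_def intro: nijenhuis_hom_comp)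

context nijenhuis_lie_algebra begin

lemmas nij_simps = linear_mapD[OF nij_linear]

end

lemma nijenhuis_iso_inv_into:
  assumes "nijenhuis_lie_algebra K A" and iso: "nijenhuis_iso K A B f"
  shows "nijenhuis_iso K B A (inv_into (carrier A) f)"
proof -
  interpret A: nijenhuis_lie_algebra K A by fact
  let ?h = "inv_into (carrier A) f"
  have f: "linear_map K A B f" and bij: "bij_betw f (carrier A) (carrier B)"
    using iso by (simp_all add: nijenhuis_iso_def nijenhuis_hom_def)
  have h: "?h y \<in> carrier A" "f (?h y) = y" if "y \<in> carrier B" for y
    using bij that by (auto simp: bij_betw_def f_inv_into_f inv_into_into)
  have eq: "?h y = x" if "x \<in> carrier A" "f x = y" for x y
    using bij that by (auto simp: bij_betw_def)
  have "?h \<lblot>x, y\<rblot>\<^bsub>B\<^esub> = \<lblot>?h x, ?h y\<rblot>\<^bsub>A\<^esub>" if "x \<in> carrier B" "y \<in> carrier B" for x y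
    using that iso h by (intro eq) (auto simp: nijenhuis_iso_def nijenhuis_hom_def A.bracket_closed)
  moreover have "?h (nij B x) = nij A (?h x)" if "x \<in> carrier B" for x
    using that iso h by (intro eq) (auto simp: nijenhuis_iso_def nijenhuis_hom_def A.nij_simps)
  ultimately show ?thesis
    using linear_map_inv_into[OF f bij] bij_betw_inv_into[OF bij]
    by (simp add: nijenhuis_iso_def nijenhuis_hom_def)
qed

lemma nijenhuis_lie_algebra_pullback:
  assumes "nijenhuis_lie_algebra K B" and iso: "nijenhuis_iso K A B f"
    and closed: "\<And>x y. x \<in> carrier A \<Longrightarrow> y \<in> carrier A \<Longrightarrow> \<lblot>x, y\<rblot>\<^bsub>A\<^esub> \<in> carrier A"
      "\<And>x. x \<in> carrier A \<Longrightarrow> nij A x \<in> carrier A"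
  shows "nijenhuis_lie_algebra K A"
proof -
  interpret B: nijenhuis_lie_algebra K B by fact
  have lin: "linear_map K A B f" and bij: "bij_betw f (carrier A) (carrier B)"
    and hom: "\<And>x y. x \<in> carrier A \<Longrightarrow> y \<in> carrier A \<Longrightarrow> f \<lblot>x, y\<rblot>\<^bsub>A\<^esub> = \<lblot>f x, f y\<rblot>\<^bsub>B\<^esub>"
      "\<And>x. x \<in> carrier A \<Longrightarrow> f (nij A x) = nij B (f x)"
    using iso by (simp_all add: nijenhuis_iso_def nijenhuis_hom_def)
  interpret A: vectorspace K A using lin by (simp add: linear_map_iff)
  have eqI: "x = y" if "x \<in> carrier A" "y \<in> carrier A" "f x = f y" for x y
    using bij that by (metis bij_betw_def inj_on_def)
  note [simp] = closed hom linear_mapD[OF lin] B.bracket_left B.bracket_right B.nij_simps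
  show ?thesis
  proof (intro nijenhuis_lie_algebra.intro lie_algebra.intro lie_algebra_axioms.intro
      nijenhuis_lie_algebra_axioms.intro A.vectorspace_axioms)
    show "bilinear_map K A A A (bracket A)"
      by (rule bilinear_mapI) (auto intro!: eqI A.vectorspace_axioms)
    show "linear_map K A A (nij A)"
      by (auto simp: linear_map_iff intro!: eqI A.vectorspace_axioms)
  next
    fix x y z assume "x \<in> carrier A" "y \<in> carrier A" "z \<in> carrier A"
    then show "\<lblot>x, \<lblot>y, z\<rblot>\<^bsub>A\<^esub>\<rblot>\<^bsub>A\<^esub> \<oplus>\<^bsub>A\<^esub> \<lblot>y, \<lblot>z, x\<rblot>\<^bsub>A\<^esub>\<rblot>\<^bsub>A\<^esub> \<oplus>\<^bsub>A\<^esub> \<lblot>z, \<lblot>x, y\<rblot>\<^bsub>A\<^esub>\<rblot>\<^bsub>A\<^esub> = \<zero>\<^bsub>A\<^esub>"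
      using B.jacobi[of "f x" "f y" "f z"] by (intro eqI) simp_all
  next
    fix x assume "x \<in> carrier A"
    then show "\<lblot>x, x\<rblot>\<^bsub>A\<^esub> = \<zero>\<^bsub>A\<^esub>"
      using B.bracket_alternating[of "f x"] by (intro eqI) simp_all
  next
    fix x y assume xy: "x \<in> carrier A" "y \<in> carrier A"
    have "\<lblot>f (nij A x), f (nij A y)\<rblot>\<^bsub>B\<^esub> =
      f (nij A (\<lblot>nij A x, y\<rblot>\<^bsub>A\<^esub> \<oplus>\<^bsub>A\<^esub> \<lblot>x, nij A y\<rblot>\<^bsub>A\<^esub> \<ominus>\<^bsub>A\<^esub> nij A \<lblot>x, y\<rblot>\<^bsub>A\<^esub>))"
      using B.nij_bracket[of "f x" "f y"] xy by simp
    then show "\<lblot>nij A x, nij A y\<rblot>\<^bsub>A\<^esub> =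
      nij A (\<lblot>nij A x, y\<rblot>\<^bsub>A\<^esub> \<oplus>\<^bsub>A\<^esub> \<lblot>x, nij A y\<rblot>\<^bsub>A\<^esub> \<ominus>\<^bsub>A\<^esub> nij A \<lblot>x, y\<rblot>\<^bsub>A\<^esub>)"
      using xy by (intro eqI) simp_all
  qed
qed

section \<open>Equivalence of extensions\<close>

text \<open>The total spaces may have different types. This is what allows an arbitrary extension to be
  compared with one carried by \<open>carrier V \<times> carrier G\<close>; for extensions with the same type of
  total space the relation is \<^const>\<open>extension_iso\<close>.\<close>

definition equivalent_extensions where
  "equivalent_extensions K V = (\<lambda>(E, i, p) (E', i', p').
     \<exists>\<Phi>. nijenhuis_iso K E E' \<Phi> \<and> (\<forall>v\<in>carrier V. \<Phi> (i v) = i' v) \<and>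
       (\<forall>e\<in>carrier E. p' (\<Phi> e) = p e))"

lemma equivalent_extensions_sym:
  assumes ext: "(E, i, p) \<in> abelian_extensions K G V \<rho> S"
    and eq: "equivalent_extensions K V (E, i, p) (E', i', p')"
  shows "equivalent_extensions K V (E', i', p') (E, i, p)"
proof -
  obtain \<Phi> where \<Phi>: "nijenhuis_iso K E E' \<Phi>" "\<forall>v\<in>carrier V. \<Phi> (i v) = i' v"
      "\<forall>e\<in>carrier E. p' (\<Phi> e) = p e"
    using eq by (auto simp: equivalent_extensions_def)
  let ?\<Psi> = "inv_into (carrier E) \<Phi>"
  have bij: "bij_betw \<Phi> (carrier E) (carrier E')" using \<Phi>(1) by (simp add: nijenhuis_iso_def)
  have nla: "nijenhuis_lie_algebra K E" and i: "i ` carrier V \<subseteq> carrier E"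
    using ext by (auto simp: abelian_extensions_def abelian_extension_def)
  have "?\<Psi> (i' v) = i v" if "v \<in> carrier V" for v
    using that \<Phi>(2) bij i by (metis bij_betw_def image_subset_iff inv_into_f_f)
  moreover have "p (?\<Psi> e) = p' e" if "e \<in> carrier E'" for e
    using that \<Phi>(3) bij by (metis bij_betw_def f_inv_into_f inv_into_into)
  ultimately show ?thesis
    using nijenhuis_iso_inv_into[OF nla \<Phi>(1)] by (auto simp: equivalent_extensions_def)
qed

lemma equivalent_extensions_trans:
  assumes "equivalent_extensions K V (E, i, p) (E', i', p')"
    and "equivalent_extensions K V (E', i', p') (E'', i'', p'')"
  shows "equivalent_extensions K V (E, i, p) (E'', i'', p'')"
proof -
  obtain \<Phi> \<Psi> where \<Phi>: "nijenhuis_iso K E E' \<Phi>" "\<forall>v\<in>carrier V. \<Phi> (i v) = i' v"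
      "\<forall>e\<in>carrier E. p' (\<Phi> e) = p e"
    and \<Psi>: "nijenhuis_iso K E' E'' \<Psi>" "\<forall>v\<in>carrier V. \<Psi> (i' v) = i'' v"
      "\<forall>e\<in>carrier E'. p'' (\<Psi> e) = p' e"
    using assms by (auto simp: equivalent_extensions_def)
  have "\<Phi> e \<in> carrier E'" if "e \<in> carrier E" for e
    using \<Phi>(1) that by (auto simp: nijenhuis_iso_def bij_betw_def)
  then show ?thesis
    using nijenhuis_iso_comp[OF \<Phi>(1) \<Psi>(1)] \<Phi>(2,3) \<Psi>(2,3)
    by (auto simp: equivalent_extensions_def)
qed

context nijenhuis_representation begin

lemmas rho_left = linear_mapD[OF bilinear_map_left[OF rep_bilinear]]
  and rho_right = linear_mapD[OF bilinear_map_right[OF rep_bilinear]]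
  and S_simps = linear_mapD[OF S_linear]

lemma rho_closed: "x \<in> carrier G \<Longrightarrow> v \<in> carrier V \<Longrightarrow> \<rho> x v \<in> carrier V"
  by (rule rho_left)

text \<open>Being an extension that induces \<open>\<rho>\<close> is invariant under equivalence: up to their values outside the
  carriers, \<open>i'\<close> and \<open>p'\<close> are \<open>i\<close> followed by \<open>\<Phi>\<close> and the inverse of \<open>\<Phi>\<close> followed by \<open>p\<close>,
  and \<open>\<Phi>\<close> carries sections to sections.\<close>

lemma abelian_extensions_transport:
  assumes ext: "(E, i, p) \<in> abelian_extensions K G V \<rho> S"
    and E': "nijenhuis_lie_algebra K E'"
    and eq: "equivalent_extensions K V (E, i, p) (E', i', p')"
  shows "(E', i', p') \<in> abelian_extensions K G V \<rho> S"
proof -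
  obtain \<Phi> where \<Phi>: "nijenhuis_iso K E E' \<Phi>" "\<forall>v\<in>carrier V. \<Phi> (i v) = i' v"
      "\<forall>e\<in>carrier E. p' (\<Phi> e) = p e"
    using eq by (auto simp: equivalent_extensions_def)
  let ?\<Psi> = "inv_into (carrier E) \<Phi>" and ?T = "trivial_nijenhuis V S"
  have bij: "bij_betw \<Phi> (carrier E) (carrier E')" and \<Phi>hom: "nijenhuis_hom K E E' \<Phi>"
    using \<Phi>(1) by (simp_all add: nijenhuis_iso_def)
  interpret E: nijenhuis_lie_algebra K E
    using ext by (simp add: abelian_extensions_def abelian_extension_def)
  interpret E': nijenhuis_lie_algebra K E' by fact
  have i: "nijenhuis_hom K ?T E i" and p: "nijenhuis_hom K E G p"
    and inj: "inj_on i (carrier V)" and im: "i ` carrier V = {e \<in> carrier E. p e = \<zero>\<^bsub>G\<^esub>}"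
    and surj: "p ` carrier E = carrier G"
    using ext by (simp_all add: abelian_extensions_def abelian_extension_def)
  have iE: "i v \<in> carrier E" if "v \<in> carrier V" for v using im that by blast
  have "nijenhuis_hom K ?T E' i'"
    using \<Phi>(2)
    by (intro nijenhuis_hom_cong[OF nijenhuis_hom_comp[OF i \<Phi>hom]])
      (auto simp: trivial_nijenhuis_def S_simps)
  moreover have "nijenhuis_hom K E' G p'"
  proof (rule nijenhuis_hom_cong)
    have "nijenhuis_iso K E' E ?\<Psi>" by (rule nijenhuis_iso_inv_into[OF E.nijenhuis_lie_algebra_axioms \<Phi>(1)])
    then show "nijenhuis_hom K E' G (\<lambda>e. p (?\<Psi> e))"
      using p by (auto simp: nijenhuis_iso_def intro: nijenhuis_hom_comp)
    show "p' e = p (?\<Psi> e)" if "e \<in> carrier E'" for e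
      using that \<Phi>(3) bij by (metis bij_betw_def f_inv_into_f inv_into_into)
  qed (auto simp: E'.bracket_closed E'.nij_simps)
  moreover have "inj_on i' (carrier V)"
    using inj \<Phi>(2) iE bij unfolding inj_on_def bij_betw_def by metis
  moreover have "i' ` carrier V = {e \<in> carrier E'. p' e = \<zero>\<^bsub>G\<^esub>}"
  proof -
    have "i' ` carrier V = \<Phi> ` (i ` carrier V)" using \<Phi>(2) by (simp add: image_image)
    also have "\<dots> = \<Phi> ` {e \<in> carrier E. p' (\<Phi> e) = \<zero>\<^bsub>G\<^esub>}" using \<Phi>(3) im by auto
    also have "\<dots> = {e \<in> carrier E'. p' e = \<zero>\<^bsub>G\<^esub>}"
      using bij_betw_imp_surj_on[OF bij, symmetric] by auto
    finally show ?thesis .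
  qed
  moreover have "p' ` carrier E' = carrier G"
  proof -
    have "p' ` carrier E' = p' ` (\<Phi> ` carrier E)" using bij by (simp add: bij_betw_def)
    also have "\<dots> = p ` carrier E" using \<Phi>(3) by (simp add: image_image)
    finally show ?thesis using surj by simp
  qed
  moreover have "induces_representation K G V \<rho> E' i' p'"
  proof -
    obtain s where s: "is_section K G E p s"
      and rep: "\<forall>x\<in>carrier G. \<forall>v\<in>carrier V. i (\<rho> x v) = \<lblot>s x, i v\<rblot>\<^bsub>E\<^esub>"
      using ext by (auto simp: abelian_extensions_def induces_representation_def)
    have sE: "s x \<in> carrier E" if "x \<in> carrier G" for x
      using s that by (simp add: is_section_def linear_map_iff)
    have "is_section K G E' p' (\<lambda>x. \<Phi> (s x))"
      using s \<Phi>(3) \<Phi>hom sE by (auto simp: is_section_def nijenhuis_hom_def intro: linear_map_comp)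
    moreover have "i' (\<rho> x v) = \<lblot>\<Phi> (s x), i' v\<rblot>\<^bsub>E'\<^esub>" if "x \<in> carrier G" "v \<in> carrier V" for x v
    proof -
      have "i' (\<rho> x v) = \<Phi> (i (\<rho> x v))" using that \<Phi>(2) by (simp add: rho_closed)
      also have "\<dots> = \<lblot>\<Phi> (s x), \<Phi> (i v)\<rblot>\<^bsub>E'\<^esub>"
        using that rep \<Phi>hom sE iE by (simp add: nijenhuis_hom_def)
      finally show ?thesis using that \<Phi>(2) by simp
    qed
    ultimately show ?thesis unfolding induces_representation_def by blast
  qed
  ultimately show ?thesis
    using E' by (simp add: abelian_extensions_def abelian_extension_def)
qed

end

text \<open>Transport of structure along an injection, which moves an extension to a prescribed type.\<close>

lemma equivalent_extension_in_universe:
  fixes E :: "('k, 'a) nijenhuis_lie_algebra" and j :: "'a \<Rightarrow> 'e"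
  assumes E: "nijenhuis_lie_algebra K E" and j: "inj_on j (carrier E)"
    and i: "\<And>v. v \<in> carrier V \<Longrightarrow> i v \<in> carrier E"
  obtains E' :: "('k, 'e) nijenhuis_lie_algebra" and i' p'
  where "nijenhuis_lie_algebra K E'" and "equivalent_extensions K V (E, i, p) (E', i', p')"
proof -
  interpret E: nijenhuis_lie_algebra K E by fact
  define h where "h = inv_into (carrier E) j"
  define E' :: "('k, 'e) nijenhuis_lie_algebra" where
    "E' = \<lparr>carrier = j ` carrier E, mult = (\<lambda>_ _. j \<zero>\<^bsub>E\<^esub>), one = j \<zero>\<^bsub>E\<^esub>, zero = j \<zero>\<^bsub>E\<^esub>,
       add = (\<lambda>x y. j (h x \<oplus>\<^bsub>E\<^esub> h y)), smult = (\<lambda>a x. j (a \<odot>\<^bsub>E\<^esub> h x)),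
       bracket = (\<lambda>x y. j \<lblot>h x, h y\<rblot>\<^bsub>E\<^esub>), nij = (\<lambda>x. j (nij E (h x)))\<rparr>"
  have h [simp]: "h (j x) = x" if "x \<in> carrier E" for x
    using j that by (simp add: h_def)
  have bij: "bij_betw h (carrier E') (carrier E)"
    by (rule bij_betw_byWitness[where f' = j]) (auto simp: E'_def)
  have lin: "linear_map K E' E h"
    by (rule vectorspace_pullback[OF E.vectorspace_axioms bij]) (auto simp: E'_def)
  then have iso: "nijenhuis_iso K E' E h"
    using bij by (auto simp: nijenhuis_iso_def nijenhuis_hom_def E'_def E.bracket_closed E.nij_simps)
  have "nijenhuis_lie_algebra K E'"
    by (rule nijenhuis_lie_algebra_pullback[OF E.nijenhuis_lie_algebra_axioms iso])
      (auto simp: E'_def E.bracket_closed E.nij_simps)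
  moreover have "nijenhuis_iso K E E' j"
    using j E.vectorspace_axioms lin
    by (auto simp: nijenhuis_iso_def nijenhuis_hom_def linear_map_iff E'_def bij_betw_def)
  then have "equivalent_extensions K V (E, i, p) (E', \<lambda>v. j (i v), \<lambda>e. p (h e))"
    by (auto simp: equivalent_extensions_def intro!: exI[of _ j])
  ultimately show ?thesis by (rule that)
qed

section \<open>Twisted sums and cocycles\<close>

text \<open>The vector space underlying this algebra is \<^const>\<open>direct_sum\<close>. For \<open>\<chi> = 0\<close> and \<open>F = 0\<close> it is the
  semidirect product of \<open>G\<close> and \<open>V\<close>; the pair \<open>(\<chi>, F)\<close> measures how far \<open>x \<mapsto> (0, x)\<close>
  is from being a homomorphism of Nijenhuis Lie algebras.\<close>

definition twisted_sum where
  "twisted_sum G V \<rho> S \<chi> F =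
     \<lparr>carrier = carrier V \<times> carrier G, mult = (\<lambda>_ _. (\<zero>\<^bsub>V\<^esub>, \<zero>\<^bsub>G\<^esub>)), one = (\<zero>\<^bsub>V\<^esub>, \<zero>\<^bsub>G\<^esub>),
      zero = (\<zero>\<^bsub>V\<^esub>, \<zero>\<^bsub>G\<^esub>), add = (\<lambda>(v, x) (w, y). (v \<oplus>\<^bsub>V\<^esub> w, x \<oplus>\<^bsub>G\<^esub> y)),
      smult = (\<lambda>a (v, x). (a \<odot>\<^bsub>V\<^esub> v, a \<odot>\<^bsub>G\<^esub> x)),
      bracket = (\<lambda>(v, x) (w, y). (\<rho> x w \<ominus>\<^bsub>V\<^esub> \<rho> y v \<oplus>\<^bsub>V\<^esub> \<chi> x y, \<lblot>x, y\<rblot>\<^bsub>G\<^esub>)),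
      nij = (\<lambda>(v, x). (S v \<oplus>\<^bsub>V\<^esub> F x, nij G x))\<rparr>"

lemma twisted_sum_simps [simp]:
  "carrier (twisted_sum G V \<rho> S \<chi> F) = carrier V \<times> carrier G"
  "\<zero>\<^bsub>twisted_sum G V \<rho> S \<chi> F\<^esub> = (\<zero>\<^bsub>V\<^esub>, \<zero>\<^bsub>G\<^esub>)"
  "(v, x) \<oplus>\<^bsub>twisted_sum G V \<rho> S \<chi> F\<^esub> (w, y) = (v \<oplus>\<^bsub>V\<^esub> w, x \<oplus>\<^bsub>G\<^esub> y)"
  "a \<odot>\<^bsub>twisted_sum G V \<rho> S \<chi> F\<^esub> (v, x) = (a \<odot>\<^bsub>V\<^esub> v, a \<odot>\<^bsub>G\<^esub> x)"
  "\<lblot>(v, x), (w, y)\<rblot>\<^bsub>twisted_sum G V \<rho> S \<chi> F\<^esub> =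
     (\<rho> x w \<ominus>\<^bsub>V\<^esub> \<rho> y v \<oplus>\<^bsub>V\<^esub> \<chi> x y, \<lblot>x, y\<rblot>\<^bsub>G\<^esub>)"
  "nij (twisted_sum G V \<rho> S \<chi> F) (v, x) = (S v \<oplus>\<^bsub>V\<^esub> F x, nij G x)"
  by (simp_all add: twisted_sum_def)

definition twisted_extension where
  "twisted_extension G V \<rho> S = (\<lambda>(\<chi>, F).
     (twisted_sum G V \<rho> S \<chi> F, \<lambda>v. (v, \<zero>\<^bsub>G\<^esub>), snd))"

context nijenhuis_representation begin

abbreviation twisted where "twisted \<equiv> twisted_sum G V \<rho> S"

lemma vectorspace_twisted: "vectorspace K (twisted \<chi> F)"
proof (rule vectorspace_pullback)
  show "vectorspace K (direct_sum V G)"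
    by (rule direct_sum_is_vs) (rule V.vectorspace_axioms vectorspace_axioms)+
  show "bij_betw id (carrier (twisted \<chi> F)) (carrier (direct_sum V G))"
    by (simp add: direct_sum_def)
qed (auto simp: direct_sum_def)

lemma minus_twisted:
  assumes "v \<in> carrier V" "x \<in> carrier G" "w \<in> carrier V" "y \<in> carrier G"
  shows "(v, x) \<ominus>\<^bsub>twisted \<chi> F\<^esub> (w, y) = (v \<ominus>\<^bsub>V\<^esub> w, x \<ominus> y)"
proof -
  interpret T: vectorspace K "twisted \<chi> F" by (rule vectorspace_twisted)
  have "\<ominus>\<^bsub>twisted \<chi> F\<^esub> (w, y) = (\<ominus>\<^bsub>V\<^esub> w, \<ominus> y)"
    using assms by (intro T.M.minus_equality) (simp_all add: V.M.l_neg M.l_neg)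
  then show ?thesis by (simp add: a_minus_def)
qed

lemma linear_maps_of_twisted:
  shows "linear_map K (twisted \<chi> F) V fst" and "linear_map K (twisted \<chi> F) G snd"
    and "linear_map K G (twisted \<chi> F) (\<lambda>x. (\<zero>\<^bsub>V\<^esub>, x))"
  using vectorspace_twisted[of \<chi> F] vectorspace_axioms V.vectorspace_axioms
  by (auto simp: linear_map_iff)

text \<open>The axioms of a Nijenhuis Lie algebra, evaluated at pairs \<open>(0, x)\<close>, have the cocycle conditions
  as their components in \<open>V\<close>.\<close>

lemma two_cocycle_of_twisted:
  assumes T: "nijenhuis_lie_algebra K (twisted \<chi> F)"
    and \<chi>V: "\<And>x y. x \<in> carrier G \<Longrightarrow> y \<in> carrier G \<Longrightarrow> \<chi> x y \<in> carrier V"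
    and FV: "\<And>x. x \<in> carrier G \<Longrightarrow> F x \<in> carrier V"
  shows "two_cocycle K G V \<rho> S \<chi> F"
proof -
  interpret T: nijenhuis_lie_algebra K "twisted \<chi> F" by fact
  note [simp] = \<chi>V FV rho_closed rho_left(4) rho_right(4) S_simps bracket_closed nij_simps
    bracket_left(4) bracket_right(4)  minus_twisted V.M.a_inv_zero V.M.minus_eq M.minus_eq
  have \<chi>: "fst \<lblot>(\<zero>\<^bsub>V\<^esub>, x), (\<zero>\<^bsub>V\<^esub>, y)\<rblot>\<^bsub>twisted \<chi> F\<^esub> = \<chi> x y"
    if "x \<in> carrier G" "y \<in> carrier G" for x y
    using that by simp
  note to_V = linear_maps_of_twisted(1)[of \<chi> F] and in_G = linear_maps_of_twisted(3)[of \<chi> F]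
  have lin1: "linear_map K G V (\<lambda>x. \<chi> x y)" if "y \<in> carrier G" for y
  proof (rule linear_map_cong)
    show "linear_map K G V (\<lambda>x. fst \<lblot>(\<zero>\<^bsub>V\<^esub>, x), (\<zero>\<^bsub>V\<^esub>, y)\<rblot>\<^bsub>twisted \<chi> F\<^esub>)"
      using that by (intro linear_map_comp[OF in_G linear_map_comp[OF
              bilinear_map_left[OF T.bracket_bilinear] to_V]]) simp
  qed (use that in simp)
  have lin2: "linear_map K G V (\<chi> x)" if "x \<in> carrier G" for x
  proof (rule linear_map_cong)
    show "linear_map K G V (\<lambda>y. fst \<lblot>(\<zero>\<^bsub>V\<^esub>, x), (\<zero>\<^bsub>V\<^esub>, y)\<rblot>\<^bsub>twisted \<chi> F\<^esub>)"
      using that by (intro linear_map_comp[OF in_G linear_map_comp[OF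
              bilinear_map_right[OF T.bracket_bilinear] to_V]]) simp
  qed (use that in simp)
  have bil: "bilinear_map K G G V \<chi>" using lin1 lin2 by (simp add: bilinear_map_def)
  have linF: "linear_map K G V F"
  proof (rule linear_map_cong)
    show "linear_map K G V (\<lambda>x. fst (nij (twisted \<chi> F) (\<zero>\<^bsub>V\<^esub>, x)))"
      by (rule linear_map_comp[OF in_G linear_map_comp[OF T.nij_linear to_V]])
  qed simp
  have alt: "\<chi> x x = \<zero>\<^bsub>V\<^esub>" if "x \<in> carrier G" for x
    using T.bracket_alternating[of "(\<zero>\<^bsub>V\<^esub>, x)"] that by simp
  have skew: "\<chi> y x = \<ominus>\<^bsub>V\<^esub> \<chi> x y" if "x \<in> carrier G" "y \<in> carrier G" for x y
  proof -
    have "\<zero>\<^bsub>V\<^esub> = \<chi> (x \<oplus> y) (x \<oplus> y)" using that by (simp add: alt)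
    also have "\<dots> = \<chi> x y \<oplus>\<^bsub>V\<^esub> \<chi> y x"
      using that alt[of x] alt[of y]
      by (simp add: linear_mapD[OF lin1] linear_mapD[OF lin2] V.M.a_comm)
    finally show ?thesis using that by (metis V.M.a_comm V.M.minus_equality \<chi>V)
  qed
  have jac: "\<rho> x (\<chi> y z) \<oplus>\<^bsub>V\<^esub> \<rho> y (\<chi> z x) \<oplus>\<^bsub>V\<^esub> \<rho> z (\<chi> x y)
     \<ominus>\<^bsub>V\<^esub> \<chi> \<lblot>x, y\<rblot> z \<ominus>\<^bsub>V\<^esub> \<chi> \<lblot>y, z\<rblot> x \<ominus>\<^bsub>V\<^esub> \<chi> \<lblot>z, x\<rblot> y = \<zero>\<^bsub>V\<^esub>"
    if "x \<in> carrier G" "y \<in> carrier G" "z \<in> carrier G" for x y z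
    using T.jacobi[of "(\<zero>\<^bsub>V\<^esub>, x)" "(\<zero>\<^bsub>V\<^esub>, y)" "(\<zero>\<^bsub>V\<^esub>, z)"] that
    by (simp add: skew[of _ "\<lblot>_,_\<rblot>"] V.M.a_ac)
  have nij: "\<chi> (nij G x) (nij G y)
       \<ominus>\<^bsub>V\<^esub> S (\<chi> (nij G x) y \<oplus>\<^bsub>V\<^esub> \<chi> x (nij G y) \<ominus>\<^bsub>V\<^esub> S (\<chi> x y))
       \<ominus>\<^bsub>V\<^esub> F (\<lblot>nij G x, y\<rblot> \<oplus> \<lblot>x, nij G y\<rblot> \<ominus> nij G \<lblot>x, y\<rblot>)
       \<oplus>\<^bsub>V\<^esub> \<rho> (nij G x) (F y) \<ominus>\<^bsub>V\<^esub> \<rho> (nij G y) (F x)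
       \<ominus>\<^bsub>V\<^esub> S (\<rho> x (F y) \<ominus>\<^bsub>V\<^esub> \<rho> y (F x) \<ominus>\<^bsub>V\<^esub> F \<lblot>x, y\<rblot>) = \<zero>\<^bsub>V\<^esub>"
    if "x \<in> carrier G" "y \<in> carrier G" for x y
  proof -
    have "\<rho> (nij G x) (F y) \<ominus>\<^bsub>V\<^esub> \<rho> (nij G y) (F x) \<oplus>\<^bsub>V\<^esub> \<chi> (nij G x) (nij G y) =
      S (\<ominus>\<^bsub>V\<^esub> \<rho> y (F x) \<oplus>\<^bsub>V\<^esub> \<chi> (nij G x) y \<oplus>\<^bsub>V\<^esub> (\<rho> x (F y) \<oplus>\<^bsub>V\<^esub> \<chi> x (nij G y))
          \<ominus>\<^bsub>V\<^esub> (S (\<chi> x y) \<oplus>\<^bsub>V\<^esub> F \<lblot>x, y\<rblot>)) \<oplus>\<^bsub>V\<^esub>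
        F (\<lblot>nij G x, y\<rblot> \<oplus> \<lblot>x, nij G y\<rblot> \<ominus> nij G \<lblot>x, y\<rblot>)" (is "?L = ?R")
      using T.nij_bracket[of "(\<zero>\<^bsub>V\<^esub>, x)" "(\<zero>\<^bsub>V\<^esub>, y)"] that
      by simp
    \<comment> \<open>With everything on one side, this is the cocycle condition up to the order of its summands.\<close>
    then have "?L \<ominus>\<^bsub>V\<^esub> ?R = \<zero>\<^bsub>V\<^esub>" using that by (simp add: V.M.r_neg)
    then show ?thesis
      using that by (simp add: V.M.minus_add V.M.a_ac)
  qed
  show ?thesis
    unfolding two_cocycle_def using bil alt linF jac nij by blast
qed



text \<open>Conversely, the components in \<open>V\<close> of the axioms at arbitrary pairs reduce to the cocycle conditions:
  all the terms that involve the \<open>V\<close>-components of the pairs cancel, because \<open>\<rho>\<close> respects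
  brackets (for the Jacobi identity) and \<open>S\<close> is compatible with \<open>\<rho>\<close> (for the Nijenhuis
  identity).\<close>

lemma twisted_of_two_cocycle:
  assumes coc: "two_cocycle K G V \<rho> S \<chi> F"
  shows "nijenhuis_lie_algebra K (twisted \<chi> F)"
proof -
  have bil: "bilinear_map K G G V \<chi>" and linF: "linear_map K G V F"
    and alt: "\<And>x. x \<in> carrier G \<Longrightarrow> \<chi> x x = \<zero>\<^bsub>V\<^esub>"
    and jac: "\<And>x y z. x \<in> carrier G \<Longrightarrow> y \<in> carrier G \<Longrightarrow> z \<in> carrier G \<Longrightarrow>
      \<rho> x (\<chi> y z) \<oplus>\<^bsub>V\<^esub> \<rho> y (\<chi> z x) \<oplus>\<^bsub>V\<^esub> \<rho> z (\<chi> x y)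
        \<ominus>\<^bsub>V\<^esub> \<chi> \<lblot>x, y\<rblot> z \<ominus>\<^bsub>V\<^esub> \<chi> \<lblot>y, z\<rblot> x \<ominus>\<^bsub>V\<^esub> \<chi> \<lblot>z, x\<rblot> y = \<zero>\<^bsub>V\<^esub>"
    and nij: "\<And>x y. x \<in> carrier G \<Longrightarrow> y \<in> carrier G \<Longrightarrow>
      \<chi> (nij G x) (nij G y)
        \<ominus>\<^bsub>V\<^esub> S (\<chi> (nij G x) y \<oplus>\<^bsub>V\<^esub> \<chi> x (nij G y) \<ominus>\<^bsub>V\<^esub> S (\<chi> x y))
        \<ominus>\<^bsub>V\<^esub> F (\<lblot>nij G x, y\<rblot> \<oplus> \<lblot>x, nij G y\<rblot> \<ominus> nij G \<lblot>x, y\<rblot>)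
        \<oplus>\<^bsub>V\<^esub> \<rho> (nij G x) (F y) \<ominus>\<^bsub>V\<^esub> \<rho> (nij G y) (F x)
        \<ominus>\<^bsub>V\<^esub> S (\<rho> x (F y) \<ominus>\<^bsub>V\<^esub> \<rho> y (F x) \<ominus>\<^bsub>V\<^esub> F \<lblot>x, y\<rblot>) = \<zero>\<^bsub>V\<^esub>"
    using coc unfolding two_cocycle_def by blast+
  note \<chi> = linear_mapD[OF bilinear_map_left[OF bil]] linear_mapD[OF bilinear_map_right[OF bil]]
  note [simp] = rho_closed rho_left rho_right S_simps bracket_closed nij_simps
    bracket_left bracket_right \<chi> linear_mapD[OF linF] minus_twisted
    V.M.a_inv_zero V.M.minus_eq M.minus_eq V.M.minus_add
    V.smult_r_distr smult_r_distr
  have smult_neg: "a \<odot>\<^bsub>V\<^esub> (\<ominus>\<^bsub>V\<^esub> v) = \<ominus>\<^bsub>V\<^esub> (a \<odot>\<^bsub>V\<^esub> v)" if "a \<in> carrier K" "v \<in> carrier V" for a v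
    using that by (simp add: V.smult_r_minus)
  have skew: "\<chi> y x = \<ominus>\<^bsub>V\<^esub> \<chi> x y" if "x \<in> carrier G" "y \<in> carrier G" for x y
  proof -
    have "\<chi> y x \<oplus>\<^bsub>V\<^esub> \<chi> x y = \<chi> (x \<oplus> y) (x \<oplus> y)" using that alt[of x] alt[of y] by simp
    also have "\<dots> = \<zero>\<^bsub>V\<^esub>" using that by (intro alt) simp
    finally show ?thesis using that by (simp add: V.M.minus_equality)
  qed
  show ?thesis
  proof (intro nijenhuis_lie_algebra.intro lie_algebra.intro lie_algebra_axioms.intro
      nijenhuis_lie_algebra_axioms.intro vectorspace_twisted)
    show "bilinear_map K (twisted \<chi> F) (twisted \<chi> F) (twisted \<chi> F) (bracket (twisted \<chi> F))"
      by (rule bilinear_mapI) (auto simp: vectorspace_twisted smult_neg V.M.a_ac)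
    show "linear_map K (twisted \<chi> F) (twisted \<chi> F) (nij (twisted \<chi> F))"
      by (auto simp: linear_map_iff vectorspace_twisted V.M.a_ac)
  next
    fix X assume "X \<in> carrier (twisted \<chi> F)"
    then show "\<lblot>X, X\<rblot>\<^bsub>twisted \<chi> F\<^esub> = \<zero>\<^bsub>twisted \<chi> F\<^esub>"
      by (auto simp: alt V.M.r_neg bracket_alternating)
  next
    fix X Y Z
    assume "X \<in> carrier (twisted \<chi> F)" "Y \<in> carrier (twisted \<chi> F)" "Z \<in> carrier (twisted \<chi> F)"
    then obtain u x v y w z where XYZ: "X = (u, x)" "Y = (v, y)" "Z = (w, z)"
      and [simp]: "u \<in> carrier V" "v \<in> carrier V" "w \<in> carrier V"
        "x \<in> carrier G" "y \<in> carrier G" "z \<in> carrier G"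
      by auto
    have closed: "\<rho> x (\<rho> y w) \<in> carrier V" "\<rho> x (\<rho> z v) \<in> carrier V" "\<rho> y (\<rho> x w) \<in> carrier V"
      "\<rho> y (\<rho> z u) \<in> carrier V" "\<rho> z (\<rho> x v) \<in> carrier V" "\<rho> z (\<rho> y u) \<in> carrier V"
      "\<rho> x (\<chi> y z) \<in> carrier V" "\<rho> y (\<chi> z x) \<in> carrier V" "\<rho> z (\<chi> x y) \<in> carrier V"
      "\<chi> x \<lblot>y, z\<rblot> \<in> carrier V" "\<chi> y \<lblot>z, x\<rblot> \<in> carrier V" "\<chi> z \<lblot>x, y\<rblot> \<in> carrier V"
      by simp_all
    have "fst (\<lblot>X, \<lblot>Y, Z\<rblot>\<^bsub>twisted \<chi> F\<^esub>\<rblot>\<^bsub>twisted \<chi> F\<^esub> \<oplus>\<^bsub>twisted \<chi> F\<^esub>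
        \<lblot>Y, \<lblot>Z, X\<rblot>\<^bsub>twisted \<chi> F\<^esub>\<rblot>\<^bsub>twisted \<chi> F\<^esub> \<oplus>\<^bsub>twisted \<chi> F\<^esub>
        \<lblot>Z, \<lblot>X, Y\<rblot>\<^bsub>twisted \<chi> F\<^esub>\<rblot>\<^bsub>twisted \<chi> F\<^esub>) =
      \<rho> x (\<chi> y z) \<oplus>\<^bsub>V\<^esub> \<rho> y (\<chi> z x) \<oplus>\<^bsub>V\<^esub> \<rho> z (\<chi> x y)
        \<ominus>\<^bsub>V\<^esub> \<chi> \<lblot>x, y\<rblot> z \<ominus>\<^bsub>V\<^esub> \<chi> \<lblot>y, z\<rblot> x \<ominus>\<^bsub>V\<^esub> \<chi> \<lblot>z, x\<rblot> y"
      by (simp add: XYZ rep_bracket skew[of _ "\<lblot>_,_\<rblot>"]) (rule V.M.jacobi_cancel[OF closed])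
    then show "\<lblot>X, \<lblot>Y, Z\<rblot>\<^bsub>twisted \<chi> F\<^esub>\<rblot>\<^bsub>twisted \<chi> F\<^esub> \<oplus>\<^bsub>twisted \<chi> F\<^esub>
        \<lblot>Y, \<lblot>Z, X\<rblot>\<^bsub>twisted \<chi> F\<^esub>\<rblot>\<^bsub>twisted \<chi> F\<^esub> \<oplus>\<^bsub>twisted \<chi> F\<^esub>
        \<lblot>Z, \<lblot>X, Y\<rblot>\<^bsub>twisted \<chi> F\<^esub>\<rblot>\<^bsub>twisted \<chi> F\<^esub> = \<zero>\<^bsub>twisted \<chi> F\<^esub>"
      using jacobi[of x y z] jac[of x y z] by (simp add: XYZ)
  next
    fix X Y
    assume "X \<in> carrier (twisted \<chi> F)" "Y \<in> carrier (twisted \<chi> F)"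
    then obtain v x w y where XY: "X = (v, x)" "Y = (w, y)"
      and [simp]: "v \<in> carrier V" "w \<in> carrier V" "x \<in> carrier G" "y \<in> carrier G"
      by auto
    have closed: "\<rho> (nij G x) (F y) \<in> carrier V" "\<rho> (nij G y) (F x) \<in> carrier V"
      "S (\<rho> (nij G x) w) \<in> carrier V" "S (\<rho> (nij G y) v) \<in> carrier V"
      "S (\<rho> x (S w)) \<in> carrier V" "S (\<rho> y (S v)) \<in> carrier V"
      "S (S (\<rho> x w)) \<in> carrier V" "S (S (\<rho> y v)) \<in> carrier V"
      "S (\<rho> x (F y)) \<in> carrier V" "S (\<rho> y (F x)) \<in> carrier V"
      "S (\<chi> (nij G x) y) \<in> carrier V" "S (\<chi> x (nij G y)) \<in> carrier V"
      "S (S (\<chi> x y)) \<in> carrier V" "S (F \<lblot>x, y\<rblot>) \<in> carrier V"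
      "F \<lblot>nij G x, y\<rblot> \<in> carrier V" "F \<lblot>x, nij G y\<rblot> \<in> carrier V"
      "F (nij G \<lblot>x, y\<rblot>) \<in> carrier V"
      by simp_all
    have chi_nij: "\<chi> (nij G x) (nij G y) =
        S (\<chi> (nij G x) y \<oplus>\<^bsub>V\<^esub> \<chi> x (nij G y) \<ominus>\<^bsub>V\<^esub> S (\<chi> x y))
        \<oplus>\<^bsub>V\<^esub> F (\<lblot>nij G x, y\<rblot> \<oplus> \<lblot>x, nij G y\<rblot> \<ominus> nij G \<lblot>x, y\<rblot>)
        \<ominus>\<^bsub>V\<^esub> \<rho> (nij G x) (F y) \<oplus>\<^bsub>V\<^esub> \<rho> (nij G y) (F x)
        \<oplus>\<^bsub>V\<^esub> S (\<rho> x (F y) \<ominus>\<^bsub>V\<^esub> \<rho> y (F x) \<ominus>\<^bsub>V\<^esub> F \<lblot>x, y\<rblot>)"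
      by (rule V.M.solve_for_summand[OF _ _ _ _ _ _ nij]) simp_all
    have "\<rho> (nij G x) (S w \<oplus>\<^bsub>V\<^esub> F y) \<ominus>\<^bsub>V\<^esub> \<rho> (nij G y) (S v \<oplus>\<^bsub>V\<^esub> F x) \<oplus>\<^bsub>V\<^esub> \<chi> (nij G x) (nij G y) =
       S (\<rho> (nij G x) w \<ominus>\<^bsub>V\<^esub> \<rho> y (S v \<oplus>\<^bsub>V\<^esub> F x) \<oplus>\<^bsub>V\<^esub> \<chi> (nij G x) y \<oplus>\<^bsub>V\<^esub>
         (\<rho> x (S w \<oplus>\<^bsub>V\<^esub> F y) \<ominus>\<^bsub>V\<^esub> \<rho> (nij G y) v \<oplus>\<^bsub>V\<^esub> \<chi> x (nij G y)) \<ominus>\<^bsub>V\<^esub>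
         (S (\<rho> x w \<ominus>\<^bsub>V\<^esub> \<rho> y v \<oplus>\<^bsub>V\<^esub> \<chi> x y) \<oplus>\<^bsub>V\<^esub> F \<lblot>x, y\<rblot>))
       \<oplus>\<^bsub>V\<^esub> F (\<lblot>nij G x, y\<rblot> \<oplus> \<lblot>x, nij G y\<rblot> \<ominus> nij G \<lblot>x, y\<rblot>)"
      by (simp add: rep_nij chi_nij) (rule V.M.nijenhuis_cancel[OF closed])
    then show "\<lblot>nij (twisted \<chi> F) X, nij (twisted \<chi> F) Y\<rblot>\<^bsub>twisted \<chi> F\<^esub> =
      nij (twisted \<chi> F) (\<lblot>nij (twisted \<chi> F) X, Y\<rblot>\<^bsub>twisted \<chi> F\<^esub> \<oplus>\<^bsub>twisted \<chi> F\<^esub>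
        \<lblot>X, nij (twisted \<chi> F) Y\<rblot>\<^bsub>twisted \<chi> F\<^esub> \<ominus>\<^bsub>twisted \<chi> F\<^esub>
        nij (twisted \<chi> F) \<lblot>X, Y\<rblot>\<^bsub>twisted \<chi> F\<^esub>)"
      using nij_bracket[of x y] by (simp add: XY)
  qed
qed

end

section \<open>Equivalences of twisted sums\<close>

context nijenhuis_representation begin

lemma twisted_extension_in_abelian_extensions:
  assumes coc: "two_cocycle K G V \<rho> S \<chi> F"
  shows "twisted_extension G V \<rho> S (\<chi>, F) \<in> abelian_extensions K G V \<rho> S"
proof -
  have bil: "bilinear_map K G G V \<chi>" and linF: "linear_map K G V F"
    using coc unfolding two_cocycle_def by blast+
  note [simp] = rho_closed rho_left rho_right S_simps bracket_left bracket_right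
    linear_mapD[OF bilinear_map_left[OF bil]] linear_mapD[OF bilinear_map_right[OF bil]]
    linear_mapD[OF linF] nij_simps V.M.minus_eq V.M.a_inv_zero
  interpret T: nijenhuis_lie_algebra K "twisted \<chi> F"
    by (rule twisted_of_two_cocycle[OF coc])
  have "vectorspace K (trivial_nijenhuis V S)"
    by (rule vectorspace_pullback[OF V.vectorspace_axioms, of id])
      (auto simp: trivial_nijenhuis_def)
  then have "linear_map K (trivial_nijenhuis V S) (twisted \<chi> F) (\<lambda>v. (v, \<zero>))"
    by (auto simp: linear_map_iff vectorspace_twisted trivial_nijenhuis_def)
  then have "nijenhuis_hom K (trivial_nijenhuis V S) (twisted \<chi> F) (\<lambda>v. (v, \<zero>))"
    by (auto simp: nijenhuis_hom_def trivial_nijenhuis_def)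
  moreover have "nijenhuis_hom K (twisted \<chi> F) G snd"
    using linear_maps_of_twisted(2) by (auto simp: nijenhuis_hom_def)
  moreover have "(\<lambda>v. (v, \<zero>)) ` carrier V = {e \<in> carrier (twisted \<chi> F). snd e = \<zero>}"
    by auto
  moreover have "snd ` carrier (twisted \<chi> F) = carrier G"
    using V.M.zero_closed by force
  ultimately have "abelian_extension K G V S (twisted \<chi> F) (\<lambda>v. (v, \<zero>)) snd"
    using T.nijenhuis_lie_algebra_axioms by (simp add: abelian_extension_def inj_on_def)
  moreover have "is_section K G (twisted \<chi> F) snd (\<lambda>x. (\<zero>\<^bsub>V\<^esub>, x))"
    using linear_maps_of_twisted(3) by (simp add: is_section_def)
  then have "induces_representation K G V \<rho> (twisted \<chi> F) (\<lambda>v. (v, \<zero>)) snd"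
    unfolding induces_representation_def by (intro exI[of _ "\<lambda>x. (\<zero>\<^bsub>V\<^esub>, x)"]) simp
  ultimately show ?thesis by (simp add: abelian_extensions_def twisted_extension_def)
qed

text \<open>Shears are the only linear automorphisms of \<open>V \<oplus> G\<close> that restrict to the identity of \<open>V\<close> and induce
  the identity of \<open>G\<close>. For a shear, compatibility with the brackets says exactly that \<open>\<chi>\<close> and
  \<open>\<chi>'\<close> differ by the coboundary of \<open>\<phi>\<close>, and compatibility with the Nijenhuis operators is the
  corresponding statement about \<open>F\<close> and \<open>F'\<close>.\<close>

lemma shear_hom_iff:
  assumes coc: "two_cocycle K G V \<rho> S \<chi> F" and coc': "two_cocycle K G V \<rho> S \<chi>' F'"
    and \<phi>: "linear_map K G V \<phi>"
  shows "nijenhuis_hom K (twisted \<chi> F) (twisted \<chi>' F') (\<lambda>(v, x). (v \<oplus>\<^bsub>V\<^esub> \<phi> x, x)) \<longleftrightarrow>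
    (\<forall>x\<in>carrier G. \<forall>y\<in>carrier G.
       \<chi> x y \<ominus>\<^bsub>V\<^esub> \<chi>' x y = \<rho> x (\<phi> y) \<ominus>\<^bsub>V\<^esub> \<rho> y (\<phi> x) \<ominus>\<^bsub>V\<^esub> \<phi> \<lblot>x, y\<rblot>) \<and>
    (\<forall>x\<in>carrier G. F x \<ominus>\<^bsub>V\<^esub> F' x = S (\<phi> x) \<ominus>\<^bsub>V\<^esub> \<phi> (nij G x))"
proof -
  have bil: "bilinear_map K G G V \<chi>" "bilinear_map K G G V \<chi>'"
    and linF: "linear_map K G V F" "linear_map K G V F'"
    using coc coc' unfolding two_cocycle_def by blast+
  note [simp] = rho_closed rho_left(2) rho_right(2) S_simps(1,2) bracket_closed nij_simps(1)
    linear_mapD(1)[OF bilinear_map_left[OF bil(1)]] linear_mapD(1)[OF bilinear_map_left[OF bil(2)]]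
    linear_mapD(1)[OF linF(1)] linear_mapD(1)[OF linF(2)]
    linear_mapD[OF \<phi>] V.smult_r_distr
  let ?f = "\<lambda>(v, x). (v \<oplus>\<^bsub>V\<^esub> \<phi> x, x)"
  have lin: "linear_map K (twisted \<chi> F) (twisted \<chi>' F') ?f"
    by (auto simp: linear_map_iff vectorspace_twisted V.M.a_ac)
  have bracket: "?f \<lblot>(v, x), (w, y)\<rblot>\<^bsub>twisted \<chi> F\<^esub> = \<lblot>?f (v, x), ?f (w, y)\<rblot>\<^bsub>twisted \<chi>' F'\<^esub> \<longleftrightarrow>
      \<chi> x y \<ominus>\<^bsub>V\<^esub> \<chi>' x y = \<rho> x (\<phi> y) \<ominus>\<^bsub>V\<^esub> \<rho> y (\<phi> x) \<ominus>\<^bsub>V\<^esub> \<phi> \<lblot>x, y\<rblot>"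
    if [simp]: "v \<in> carrier V" "w \<in> carrier V" "x \<in> carrier G" "y \<in> carrier G" for v w x y
    using V.M.shear_bracket_cancel[of "\<rho> x w" "\<rho> y v" "\<chi> x y" "\<phi> \<lblot>x, y\<rblot>" "\<rho> x (\<phi> y)"
        "\<rho> y (\<phi> x)" "\<chi>' x y"] by simp
  have nij: "?f (nij (twisted \<chi> F) (v, x)) = nij (twisted \<chi>' F') (?f (v, x)) \<longleftrightarrow>
      F x \<ominus>\<^bsub>V\<^esub> F' x = S (\<phi> x) \<ominus>\<^bsub>V\<^esub> \<phi> (nij G x)"
    if [simp]: "v \<in> carrier V" "x \<in> carrier G" for v x
    using V.M.shear_nij_cancel[of "S v" "F x" "\<phi> (nij G x)" "S (\<phi> x)" "F' x"] by simp
  have "nijenhuis_hom K (twisted \<chi> F) (twisted \<chi>' F') ?f \<longleftrightarrow>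
    (\<forall>v\<in>carrier V. \<forall>x\<in>carrier G. \<forall>w\<in>carrier V. \<forall>y\<in>carrier G.
      ?f \<lblot>(v, x), (w, y)\<rblot>\<^bsub>twisted \<chi> F\<^esub> = \<lblot>?f (v, x), ?f (w, y)\<rblot>\<^bsub>twisted \<chi>' F'\<^esub>) \<and>
    (\<forall>v\<in>carrier V. \<forall>x\<in>carrier G.
      ?f (nij (twisted \<chi> F) (v, x)) = nij (twisted \<chi>' F') (?f (v, x)))"
    using lin by (simp add: nijenhuis_hom_def)
  then show ?thesis using bracket nij V.M.zero_closed by (simp del: twisted_sum_simps prod.case) blast
qed

lemma equivalent_twisted_extensions_iff:
  assumes coc: "two_cocycle K G V \<rho> S \<chi> F" and coc': "two_cocycle K G V \<rho> S \<chi>' F'"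
  shows "equivalent_extensions K V
      (twisted_extension G V \<rho> S (\<chi>, F)) (twisted_extension G V \<rho> S (\<chi>', F')) \<longleftrightarrow>
    ((\<chi>, F), (\<chi>', F')) \<in> cohomologous K G V \<rho> S"
proof
  assume "((\<chi>, F), (\<chi>', F')) \<in> cohomologous K G V \<rho> S"
  then obtain \<phi> where \<phi>: "linear_map K G V \<phi>"
    and rel: "\<forall>x\<in>carrier G. \<forall>y\<in>carrier G.
       \<chi> x y \<ominus>\<^bsub>V\<^esub> \<chi>' x y = \<rho> x (\<phi> y) \<ominus>\<^bsub>V\<^esub> \<rho> y (\<phi> x) \<ominus>\<^bsub>V\<^esub> \<phi> \<lblot>x, y\<rblot>"
      "\<forall>x\<in>carrier G. F x \<ominus>\<^bsub>V\<^esub> F' x = S (\<phi> x) \<ominus>\<^bsub>V\<^esub> \<phi> (nij G x)"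
    by (auto simp: cohomologous_def)
  note [simp] = linear_mapD[OF \<phi>]
  let ?f = "\<lambda>(v, x). (v \<oplus>\<^bsub>V\<^esub> \<phi> x, x)"
  have "bij_betw ?f (carrier V \<times> carrier G) (carrier V \<times> carrier G)"
    by (rule bij_betw_byWitness[where f' = "\<lambda>(v, x). (v \<ominus>\<^bsub>V\<^esub> \<phi> x, x)"])
      (auto simp: V.M.minus_eq V.M.a_assoc V.M.l_neg V.M.r_neg)
  then have "nijenhuis_iso K (twisted \<chi> F) (twisted \<chi>' F') ?f"
    using shear_hom_iff[OF coc coc' \<phi>] rel by (simp add: nijenhuis_iso_def)
  then show "equivalent_extensions K V
      (twisted_extension G V \<rho> S (\<chi>, F)) (twisted_extension G V \<rho> S (\<chi>', F'))"
    by (auto simp: equivalent_extensions_def twisted_extension_def intro!: exI[of _ ?f])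
next
  assume "equivalent_extensions K V
      (twisted_extension G V \<rho> S (\<chi>, F)) (twisted_extension G V \<rho> S (\<chi>', F'))"
  then obtain \<Phi> where iso: "nijenhuis_iso K (twisted \<chi> F) (twisted \<chi>' F') \<Phi>"
    and V: "\<forall>v\<in>carrier V. \<Phi> (v, \<zero>) = (v, \<zero>)"
    and G: "\<forall>e\<in>carrier (twisted \<chi> F). snd (\<Phi> e) = snd e"
    by (auto simp: equivalent_extensions_def twisted_extension_def)
  have hom: "nijenhuis_hom K (twisted \<chi> F) (twisted \<chi>' F') \<Phi>" 
    and lin: "linear_map K (twisted \<chi> F) (twisted \<chi>' F') \<Phi>"
    using iso by (simp_all add: nijenhuis_iso_def nijenhuis_hom_def)
  define \<phi> where "\<phi> = (\<lambda>x. fst (\<Phi> (\<zero>\<^bsub>V\<^esub>, x)))"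
  have \<phi>: "linear_map K G V \<phi>"
    unfolding \<phi>_def
    by (rule linear_map_comp[OF linear_maps_of_twisted(3)
          linear_map_comp[OF lin linear_maps_of_twisted(1)]])
  note [simp] = linear_mapD[OF \<phi>]
  have shear: "\<Phi> (v, x) = (v \<oplus>\<^bsub>V\<^esub> \<phi> x, x)" if "v \<in> carrier V" "x \<in> carrier G" for v x
  proof -
    have "\<Phi> (v, x) = \<Phi> ((v, \<zero>) \<oplus>\<^bsub>twisted \<chi> F\<^esub> (\<zero>\<^bsub>V\<^esub>, x))" using that by simp
    also have "\<dots> = \<Phi> (v, \<zero>) \<oplus>\<^bsub>twisted \<chi>' F'\<^esub> \<Phi> (\<zero>\<^bsub>V\<^esub>, x)"
      using that by (intro linear_mapD(2)[OF lin]) simp_all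
    also have "\<Phi> (\<zero>\<^bsub>V\<^esub>, x) = (\<phi> x, x)"
      using G that by (simp add: \<phi>_def prod_eq_iff)
    finally show ?thesis using V that by simp
  qed
  interpret T: nijenhuis_lie_algebra K "twisted \<chi> F" by (rule twisted_of_two_cocycle[OF coc])
  have "nijenhuis_hom K (twisted \<chi> F) (twisted \<chi>' F') (\<lambda>(v, x). (v \<oplus>\<^bsub>V\<^esub> \<phi> x, x))"
    using shear by (intro nijenhuis_hom_cong[OF hom] T.bracket_closed T.nij_simps) auto
  then show "((\<chi>, F), (\<chi>', F')) \<in> cohomologous K G V \<rho> S"
    using shear_hom_iff[OF coc coc' \<phi>] coc coc' \<phi> by (auto simp: cohomologous_def)
qed

end

section \<open>Every extension is a twisted sum\<close>

context nijenhuis_representation begin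

text \<open>A section \<open>s\<close> gives linear coordinates \<open>(v, x) \<mapsto> i v \<oplus> s x\<close> on the total space. In these coordinates
  the structure of \<open>E\<close> becomes a twisted sum, where \<open>\<chi>\<close> and \<open>F\<close> record the failure of \<open>s\<close> to
  respect the brackets and the Nijenhuis operators. Since the twisted sum is isomorphic to \<open>E\<close>, it is
  a Nijenhuis Lie algebra, and the cocycle conditions follow without any computation in \<open>E\<close>.\<close>

lemma abelian_extension_equivalent_twisted:
  assumes ext: "(E, i, p) \<in> abelian_extensions K G V \<rho> S"
  obtains \<chi> F where "two_cocycle K G V \<rho> S \<chi> F"
    and "equivalent_extensions K V (twisted_extension G V \<rho> S (\<chi>, F)) (E, i, p)"
proof -
  interpret E: nijenhuis_lie_algebra K E
    using ext by (simp add: abelian_extensions_def abelian_extension_def)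
  have hom_i: "nijenhuis_hom K (trivial_nijenhuis V S) E i" and hom_p: "nijenhuis_hom K E G p"
    and inj: "inj_on i (carrier V)" and ker: "i ` carrier V = {e \<in> carrier E. p e = \<zero>}"
    using ext by (simp_all add: abelian_extensions_def abelian_extension_def)
  have lin_i: "linear_map K V E i"
    using hom_i V.vectorspace_axioms E.vectorspace_axioms
    by (simp add: nijenhuis_hom_def trivial_nijenhuis_def linear_map_iff)
  have i_bracket: "\<lblot>i v, i w\<rblot>\<^bsub>E\<^esub> = \<zero>\<^bsub>E\<^esub>" if "v \<in> carrier V" "w \<in> carrier V" for v w
  proof -
    have "carrier (trivial_nijenhuis V S) = carrier V" by (simp add: trivial_nijenhuis_def)
    then have "\<lblot>i v, i w\<rblot>\<^bsub>E\<^esub> = i \<lblot>v, w\<rblot>\<^bsub>trivial_nijenhuis V S\<^esub>"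
      using hom_i that by (simp only: nijenhuis_hom_def)
    then show ?thesis by (simp add: trivial_nijenhuis_def linear_mapD(4)[OF lin_i])
  qed
  have i_nij: "nij E (i v) = i (S v)" if "v \<in> carrier V" for v
    using hom_i that by (simp add: nijenhuis_hom_def trivial_nijenhuis_def)
  have lin_p: "linear_map K E G p"
    and p_bracket: "\<And>e e'. e \<in> carrier E \<Longrightarrow> e' \<in> carrier E \<Longrightarrow> p \<lblot>e, e'\<rblot>\<^bsub>E\<^esub> = \<lblot>p e, p e'\<rblot>"
    and p_nij: "\<And>e. e \<in> carrier E \<Longrightarrow> p (nij E e) = nij G (p e)"
    using hom_p by (simp_all add: nijenhuis_hom_def)
  have pi: "p (i v) = \<zero>" if "v \<in> carrier V" for v
    using ker that by blast
  obtain s where sec: "is_section K G E p s"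
    and rep: "\<And>x v. x \<in> carrier G \<Longrightarrow> v \<in> carrier V \<Longrightarrow> \<lblot>s x, i v\<rblot>\<^bsub>E\<^esub> = i (\<rho> x v)"
    using ext by (auto simp: abelian_extensions_def induces_representation_def)
  have lin_s: "linear_map K G E s" and ps: "\<And>x. x \<in> carrier G \<Longrightarrow> p (s x) = x"
    using sec by (auto simp: is_section_def)
  note [simp] = linear_mapD[OF lin_i] linear_mapD[OF lin_p] linear_mapD[OF lin_s] i_bracket i_nij
    p_bracket p_nij pi ps rep rho_closed S_simps(1) bracket_closed E.bracket_closed nij_simps(1)
    E.nij_simps E.bracket_left E.bracket_right
  have rep': "\<lblot>i v, s x\<rblot>\<^bsub>E\<^esub> = \<ominus>\<^bsub>E\<^esub> i (\<rho> x v)" if "x \<in> carrier G" "v \<in> carrier V" for x v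
    using that E.bracket_skew[of "s x" "i v"] by simp
  define r where "r = inv_into (carrier V) i"
  have r: "r e \<in> carrier V" "i (r e) = e" if "e \<in> carrier E" "p e = \<zero>" for e
  proof -
    have "e \<in> i ` carrier V" using ker that by blast
    then show "r e \<in> carrier V" "i (r e) = e" 
      by (simp_all add: r_def inv_into_into f_inv_into_f)
  qed
  define \<chi> where "\<chi> = (\<lambda>x y. r (\<lblot>s x, s y\<rblot>\<^bsub>E\<^esub> \<ominus>\<^bsub>E\<^esub> s \<lblot>x, y\<rblot>))"
  define F where "F = (\<lambda>x. r (nij E (s x) \<ominus>\<^bsub>E\<^esub> s (nij G x)))"
  have \<chi>V: "\<chi> x y \<in> carrier V" and \<chi>: "\<lblot>s x, s y\<rblot>\<^bsub>E\<^esub> = i (\<chi> x y) \<oplus>\<^bsub>E\<^esub> s \<lblot>x, y\<rblot>"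
    if "x \<in> carrier G" "y \<in> carrier G" for x y
    using that r[of "\<lblot>s x, s y\<rblot>\<^bsub>E\<^esub> \<ominus>\<^bsub>E\<^esub> s \<lblot>x, y\<rblot>"]
    by (simp_all add: \<chi>_def E.M.minus_eq M.minus_eq E.M.a_assoc E.M.l_neg M.r_neg)
  have FV: "F x \<in> carrier V" and F: "nij E (s x) = i (F x) \<oplus>\<^bsub>E\<^esub> s (nij G x)"
    if "x \<in> carrier G" for x
    using that r[of "nij E (s x) \<ominus>\<^bsub>E\<^esub> s (nij G x)"]
    by (simp_all add: F_def E.M.minus_eq M.minus_eq E.M.a_assoc E.M.l_neg M.r_neg)
  let ?f = "\<lambda>(v, x). i v \<oplus>\<^bsub>E\<^esub> s x"
  note [simp] = \<chi>V FV
  have "linear_map K (twisted \<chi> F) E ?f"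
    by (auto simp: linear_map_iff vectorspace_twisted E.vectorspace_axioms E.M.a_ac
        E.smult_r_distr)
  moreover have "?f \<lblot>(v, x), (w, y)\<rblot>\<^bsub>twisted \<chi> F\<^esub> = \<lblot>?f (v, x), ?f (w, y)\<rblot>\<^bsub>E\<^esub>"
    if "v \<in> carrier V" "x \<in> carrier G" "w \<in> carrier V" "y \<in> carrier G" for v x w y
    using that by (simp add: \<chi> rep' E.M.minus_eq E.M.a_ac)
  moreover have "?f (nij (twisted \<chi> F) (v, x)) = nij E (?f (v, x))"
    if "v \<in> carrier V" "x \<in> carrier G" for v x
    using that by (simp add: F E.M.a_assoc)
  ultimately have hom: "nijenhuis_hom K (twisted \<chi> F) E ?f"
    by (simp add: nijenhuis_hom_def)
  have bij: "bij_betw ?f (carrier V \<times> carrier G) (carrier E)"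
  proof (rule bij_betw_byWitness[where f' = "\<lambda>e. (r (e \<ominus>\<^bsub>E\<^esub> s (p e)), p e)"])
    have "r (i v \<oplus>\<^bsub>E\<^esub> s x \<ominus>\<^bsub>E\<^esub> s x) = v" if "v \<in> carrier V" "x \<in> carrier G" for v x
      using that inj by (simp add: r_def E.M.minus_eq E.M.a_assoc E.M.r_neg)
    then show "\<forall>t\<in>carrier V \<times> carrier G. (r (?f t \<ominus>\<^bsub>E\<^esub> s (p (?f t))), p (?f t)) = t"
      by auto
    show "\<forall>e\<in>carrier E. ?f (r (e \<ominus>\<^bsub>E\<^esub> s (p e)), p e) = e"
      by (simp add: r E.M.minus_eq E.M.a_assoc E.M.l_neg M.r_neg)
  qed (auto simp: r)
  have iso: "nijenhuis_iso K (twisted \<chi> F) E ?f"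
    using hom bij by (simp add: nijenhuis_iso_def)
  have "nijenhuis_lie_algebra K (twisted \<chi> F)"
    by (rule nijenhuis_lie_algebra_pullback[OF E.nijenhuis_lie_algebra_axioms iso]) auto
  then have "two_cocycle K G V \<rho> S \<chi> F"
    by (rule two_cocycle_of_twisted) simp_all
  moreover have "equivalent_extensions K V (twisted_extension G V \<rho> S (\<chi>, F)) (E, i, p)"
    using iso by (auto simp: equivalent_extensions_def twisted_extension_def intro!: exI[of _ ?f])
  ultimately show ?thesis by (rule that)
qed

end

section \<open>The classification of abelian extensions\<close>

text \<open>Both relations are determined by \<open>R\<close>: two elements of \<open>A\<close> are related by \<open>r\<close> if and only if they
  have the same partners in \<open>B\<close>, and vice versa for \<open>s\<close>. In particular they are equivalence
  relations on \<open>A\<close> and \<open>B\<close>. The bijection sends the class of \<open>a\<close> to the class of any partner of \<open>a\<close>.\<close>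

lemma bij_betw_quotients:
  assumes total: "\<And>a. a \<in> A \<Longrightarrow> \<exists>b\<in>B. R a b" and surj: "\<And>b. b \<in> B \<Longrightarrow> \<exists>a\<in>A. R a b"
    and r: "r \<subseteq> A \<times> A" and s: "s \<subseteq> B \<times> B"
    and left: "\<And>a a' b. a \<in> A \<Longrightarrow> a' \<in> A \<Longrightarrow> b \<in> B \<Longrightarrow> R a b \<Longrightarrow> (a, a') \<in> r \<longleftrightarrow> R a' b"
    and right: "\<And>a b b'. a \<in> A \<Longrightarrow> b \<in> B \<Longrightarrow> b' \<in> B \<Longrightarrow> R a b \<Longrightarrow> (b, b') \<in> s \<longleftrightarrow> R a b'"
  shows "\<exists>f. bij_betw f (A // r) (B // s)"
proof -
  define f where "f = (\<lambda>X. {b \<in> B. \<exists>a\<in>X. R a b})"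
  define g where "g = (\<lambda>Y. {a \<in> A. \<exists>b\<in>Y. R a b})"
  have f: "f (r `` {a}) = s `` {b}" and g: "g (s `` {b}) = r `` {a}"
    if "a \<in> A" "b \<in> B" "R a b" for a b
  proof -
    have ra: "r `` {a} = {a' \<in> A. R a' b}" using r left[OF that(1) _ that(2,3)] by auto
    have sb: "s `` {b} = {b' \<in> B. R a b'}" using s right[OF that(1,2) _ that(3)] by auto
    have "R a b'" if "a' \<in> A" "b' \<in> B" "R a' b" "R a' b'" for a' b'
      using right[of a' b b'] right[of a b b'] \<open>a \<in> A\<close> \<open>b \<in> B\<close> \<open>R a b\<close> that by blast
    then show "f (r `` {a}) = s `` {b}" unfolding ra sb f_def using that by blast
    have "R a' b" if "a' \<in> A" "b' \<in> B" "R a b'" "R a' b'" for a' b'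
      using left[of a a' b'] left[of a a' b] \<open>a \<in> A\<close> \<open>b \<in> B\<close> \<open>R a b\<close> that by blast
    then show "g (s `` {b}) = r `` {a}" unfolding ra sb g_def using that by blast
  qed
  have "bij_betw f (A // r) (B // s)"
  proof (rule bij_betw_byWitness[where f' = g])
    show "\<forall>X\<in>A // r. g (f X) = X" using total f g by (fastforce elim!: quotientE)
    show "\<forall>Y\<in>B // s. f (g Y) = Y" using surj f g by (fastforce elim!: quotientE)
    show "f ` (A // r) \<subseteq> B // s" using total f by (fastforce elim!: quotientE intro: quotientI)
    show "g ` (B // s) \<subseteq> A // r" using surj g by (fastforce elim!: quotientE intro: quotientI)
  qed
  then show ?thesis by blast
qed

theorem theorem3p7:
  fixes K :: "('k, 'r) ring_scheme"
    and G :: "('k, 'g, 'm) nijenhuis_lie_algebra_scheme"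
    and V :: "('k, 'v, 'n) module_scheme"
    and \<rho> :: "'g \<Rightarrow> 'v \<Rightarrow> 'v"
    and S :: "'v \<Rightarrow> 'v"
    and j :: "'v \<times> 'g \<Rightarrow> 'e"
  assumes "field K"
    and "nijenhuis_lie_algebra K G"
    and "nijenhuis_representation K G V \<rho> S"
    and universe: "inj_on j (carrier V \<times> carrier G)"
  shows "\<exists>f. bij_betw f
    (Ext K G V \<rho> S :: (('k, 'e) nijenhuis_lie_algebra \<times> ('v \<Rightarrow> 'e) \<times> ('e \<Rightarrow> 'g)) set set)
    (H2 K G V \<rho> S)"
proof -
  interpret nijenhuis_representation K G V \<rho> S by fact
  let ?A = "abelian_extensions K G V \<rho> S ::
    (('k, 'e) nijenhuis_lie_algebra \<times> ('v \<Rightarrow> 'e) \<times> ('e \<Rightarrow> 'g)) set"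
  let ?B = "two_cocycles K G V \<rho> S" and ?T = "twisted_extension G V \<rho> S"
  \<comment> \<open>An extension is matched with the cocycles whose twisted sum is equivalent to it.\<close>
  define R where "R = (\<lambda>(X :: ('k, 'e) nijenhuis_lie_algebra \<times> ('v \<Rightarrow> 'e) \<times> ('e \<Rightarrow> 'g)) c.
    equivalent_extensions K V (?T c) X)"
  have T: "?T c \<in> abelian_extensions K G V \<rho> S" if "c \<in> ?B" for c
    using that twisted_extension_in_abelian_extensions by (auto simp: two_cocycles_def)
  show ?thesis
    unfolding Ext_def H2_def
  proof (rule bij_betw_quotients[where R = R])
    fix X assume "X \<in> ?A"
    then obtain E i p where X: "X = (E, i, p)" "(E, i, p) \<in> ?A" by (cases X) auto
    then show "\<exists>c\<in>?B. R X c"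
      by (auto simp: R_def two_cocycles_def elim!: abelian_extension_equivalent_twisted)
  next
    fix c assume c: "c \<in> ?B"
    obtain \<chi> F where [simp]: "c = (\<chi>, F)" by (cases c)
    have TA: "(twisted \<chi> F, \<lambda>v. (v, \<zero>\<^bsub>G\<^esub>), snd) \<in> abelian_extensions K G V \<rho> S"
      using T[OF c] by (simp add: twisted_extension_def)
    have "nijenhuis_lie_algebra K (twisted \<chi> F)"
      using TA by (simp add: abelian_extensions_def abelian_extension_def)
    moreover have "inj_on j (carrier (twisted \<chi> F))" using universe by simp
    moreover have "(v, \<zero>\<^bsub>G\<^esub>) \<in> carrier (twisted \<chi> F)" if "v \<in> carrier V" for v
      using that by simp
    ultimately obtain E :: "('k, 'e) nijenhuis_lie_algebra" and i p
      where E: "nijenhuis_lie_algebra K E"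
      and eq: "equivalent_extensions K V (twisted \<chi> F, \<lambda>v. (v, \<zero>\<^bsub>G\<^esub>), snd :: _ \<Rightarrow> 'g) (E, i, p)"
      by (rule equivalent_extension_in_universe)
    then have "R (E, i, p) c" by (simp add: R_def twisted_extension_def)
    moreover have "(E, i, p) \<in> ?A" by (rule abelian_extensions_transport[OF TA E eq])
    ultimately show "\<exists>X\<in>?A. R X c" by blast
  next
    show "extension_iso K G V \<rho> S \<subseteq> ?A \<times> ?A" by (auto simp: extension_iso_def)
    show "cohomologous K G V \<rho> S \<subseteq> ?B \<times> ?B" by (auto simp: cohomologous_def two_cocycles_def)
  next
    fix X X' c assume "X \<in> ?A" "X' \<in> ?A" "c \<in> ?B" "R X c"
    have "(X, X') \<in> extension_iso K G V \<rho> S \<longleftrightarrow> equivalent_extensions K V X X'"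
      using \<open>X \<in> ?A\<close> \<open>X' \<in> ?A\<close>
      by (cases X; cases X') (simp add: extension_iso_def equivalent_extensions_def)
    also have "\<dots> \<longleftrightarrow> R X' c"
      using \<open>R X c\<close> T[OF \<open>c \<in> ?B\<close>] unfolding R_def
      by (metis prod_cases3 equivalent_extensions_sym equivalent_extensions_trans)
    finally show "(X, X') \<in> extension_iso K G V \<rho> S \<longleftrightarrow> R X' c" .
  next
    fix X c c' assume "X \<in> ?A" "c \<in> ?B" "c' \<in> ?B" "R X c"
    have "(c, c') \<in> cohomologous K G V \<rho> S \<longleftrightarrow> equivalent_extensions K V (?T c) (?T c')"
      using \<open>c \<in> ?B\<close> \<open>c' \<in> ?B\<close>
      by (cases c; cases c') (simp add: two_cocycles_def equivalent_twisted_extensions_iff)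
    also have "\<dots> \<longleftrightarrow> R X c'"
      using \<open>R X c\<close> T[OF \<open>c \<in> ?B\<close>] T[OF \<open>c' \<in> ?B\<close>] \<open>X \<in> ?A\<close> unfolding R_def
      by (metis prod_cases3 equivalent_extensions_sym equivalent_extensions_trans)
    finally show "(c, c') \<in> cohomologous K G V \<rho> S \<longleftrightarrow> R X c'" .
  qed
qed

end
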